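(* Let $L$ be a principal $\mathbb{T}$-bundle. Then $C_0^{\mathbb{T}}(L)$ satisfies the complex Mazur--Ulam property; that is, for each complex Banach space $X$, every surjective isometry $\Delta : S(C_0^{\mathbb{T}}(L)) \to S(X)$ admits an extension to a surjective real linear isometry $T : C_0^{\mathbb{T}}(L) \to X$.
   Context: $\mathbb{T}=\{\lambda\in\mathbb{C}:|\lambda|=1\}$. A principal $\mathbb{T}$-bundle is a subset $L$ of a Hausdorff locally convex complex space such that $0\notin L$, $L\cup\{0\}$ is compact, and $\mathbb{T}L=L$ (so $L$, with the subspace topology, is a locally compact Hausdorff space). $C_0(L)$ is the space of all complex-valued continuous functions on $L$ vanishing at infinity, with the supremum norm, and $$C_0^{\mathbb{T}}(L):=\{a\in C_0(L): a(\lambda t)=\lambda a(t)\text{ for every }(\lambda,t)\in\mathbb{T}\times L\},$$ a norm closed complex subspace of $C_0(L)$ (every commutative JB$^*$-triple is isometrically of this form). For a Banach space $X$, $S(X)$ denotes its unit sphere, with the metric induced by the norm. An isometry between the unit spheres is a distance-preserving map; no linearity is assumed. *)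

theory Defs
  imports "HOL-Analysis.Analysis"
begin

text \<open>
  The library has no type class of complex vector spaces. A complex space is given here by a
  real vector space type together with a complex scalar multiplication that restricts to the
  real one.
\<close>

locale complex_space = vector_space scaleC
  for scaleC :: "complex \<Rightarrow> 'a::real_vector \<Rightarrow> 'a" +
  assumes scaleC_of_real: "scaleC (of_real r) x = r *\<^sub>R x"

locale complex_locally_convex_space = complex_space scaleC
  for scaleC :: "complex \<Rightarrow> 'a::{real_vector, topological_ab_group_add, t2_space} \<Rightarrow> 'a" +
  assumes continuous_scaleC: "continuous_on UNIV (\<lambda>(c, x). scaleC c x)"
    and locally_convex: "\<lbrakk>open (U :: 'a set); 0 \<in> U\<rbrakk> \<Longrightarrow> \<exists>V. open V \<and> convex V \<and> 0 \<in> V \<and> V \<subseteq> U"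

locale complex_banach_space = complex_space scaleC
  for scaleC :: "complex \<Rightarrow> 'a::banach \<Rightarrow> 'a" +
  assumes norm_scaleC: "norm (scaleC c x) = cmod c * norm x"

abbreviation circle :: "complex set"
  where "circle \<equiv> sphere 0 1"

locale principal_circle_bundle = complex_locally_convex_space scaleC
  for scaleC :: "complex \<Rightarrow> 'a::{real_vector, topological_ab_group_add, t2_space} \<Rightarrow> 'a" +
  fixes L :: "'a set"
  assumes zero_notin: "0 \<notin> L"
    and compact_insert_zero: "compact (L \<union> {0})"
    and circle_invariant: "{scaleC c t | c t. c \<in> circle \<and> t \<in> L} = L"

text \<open>
  A function on \<open>L\<close> is represented by its extension by zero to the whole type, so that
  equality of representatives is equality on \<open>L\<close> and the vector space operations are pointwise.
\<close>

definition C0 :: "'a::topological_space set \<Rightarrow> ('a \<Rightarrow> complex) set"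
  where "C0 L = {a. continuous_on L a
      \<and> (\<forall>e>0. \<exists>K. compact K \<and> K \<subseteq> L \<and> (\<forall>t\<in>L - K. cmod (a t) < e))
      \<and> (\<forall>t. t \<notin> L \<longrightarrow> a t = 0)}"

definition C0T :: "(complex \<Rightarrow> 'a \<Rightarrow> 'a) \<Rightarrow> 'a::topological_space set \<Rightarrow> ('a \<Rightarrow> complex) set"
  where "C0T scaleC L = {a \<in> C0 L. \<forall>c\<in>circle. \<forall>t\<in>L. a (scaleC c t) = c * a t}"

text \<open>The supremum of the empty set of reals is unspecified in the library.\<close>

definition sup_norm :: "'a set \<Rightarrow> ('a \<Rightarrow> complex) \<Rightarrow> real"
  where "sup_norm L a = (if L = {} then 0 else (SUP t\<in>L. cmod (a t)))"

definition sphere_C0T :: "(complex \<Rightarrow> 'a \<Rightarrow> 'a) \<Rightarrow> 'a::topological_space set \<Rightarrow> ('a \<Rightarrow> complex) set"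
  where "sphere_C0T scaleC L = {a \<in> C0T scaleC L. sup_norm L a = 1}"

definition sup_isometry_on ::
    "'a set \<Rightarrow> ('a \<Rightarrow> complex) set \<Rightarrow> (('a \<Rightarrow> complex) \<Rightarrow> 'b::metric_space) \<Rightarrow> bool"
  where "sup_isometry_on L A F \<longleftrightarrow>
    (\<forall>a\<in>A. \<forall>b\<in>A. dist (F a) (F b) = sup_norm L (\<lambda>t. a t - b t))"

definition real_linear_on ::
    "('a \<Rightarrow> complex) set \<Rightarrow> (('a \<Rightarrow> complex) \<Rightarrow> 'b::real_vector) \<Rightarrow> bool"
  where "real_linear_on A T \<longleftrightarrow>
    (\<forall>a\<in>A. \<forall>b\<in>A. T (\<lambda>t. a t + b t) = T a + T b) \<and>
    (\<forall>r. \<forall>a\<in>A. T (\<lambda>t. r *\<^sub>R a t) = r *\<^sub>R T a)"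

end

theory Submission
  imports Defs "HOL-Real_Asymp.Real_Asymp"
begin

text \<open>
  For \<open>t \<in> L\<close> and \<open>|l| = 1\<close> let \<open>F\<^sub>l\<close> be the face of all norm-one \<open>a\<close> with \<open>a t = l\<close>. Testing with bumps
  \<open>a\<^sub>1 max(0, 1 - |f|/d)\<close>, \<open>f t = 0\<close>, shows that a lower bound greater than \<open>1\<close> for the distances from a point \<open>d\<close> of the sphere
  to the elements of \<open>F\<^sub>l\<close> is also a lower bound for \<open>|d t - l|\<close>. Hence \<open>\<Delta>(F\<^sub>l)\<close> is convex and \<open>\<Delta>(F\<^bsub>-l\<^esub>) = -\<Delta>(F\<^sub>l)\<close>.
  Since \<open>X\<close> is complex, \<open>i\<Delta>(F\<^sub>l)\<close> makes sense; its distances to \<open>\<plusminus>\<Delta>(F\<^sub>l)\<close> force it to be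
  \<open>\<Delta>(F\<^bsub>\<plusminus>il\<^esub>)\<close>, and then distances to these four faces show that \<open>\<Delta>(F\<^bsub>ml\<^esub>)\<close> contains \<open>m\<Delta>(F\<^sub>l)\<close> or
  the conjugate rotation of \<open>\<Delta>(F\<^sub>l)\<close>. A sublinear function supporting \<open>\<Delta>(F\<^sub>l)\<close> therefore takes the
  value of the real part of \<open>a t / l\<close> at \<open>\<Delta> a\<close>. If \<open>T\<close> is the positively homogeneous extension of \<open>\<Delta>\<close>
  and \<open>T c = T a + T b\<close>, sublinearity for all \<open>t\<close> and \<open>l\<close> gives \<open>c = a + b\<close>, so \<open>T\<close> is additive.
\<close>

section \<open>Elementary estimates in the plane and in normed spaces\<close>

text \<open>In the plane this limit is the Busemann function of the positive real ray;
  \<open>busemann_face\<close> and \<open>busemann_tangent_discs\<close> get their exact constants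
  from it.\<close>

lemma tendsto_cmod_add_real_minus:
  "((\<lambda>n::real. cmod (z + of_real n) - n) \<longlongrightarrow> Re z) at_top"
proof -
  have "((\<lambda>n::real. sqrt ((Re z + n)\<^sup>2 + (Im z)\<^sup>2) - n) \<longlongrightarrow> Re z) at_top"
    by real_asymp
  then show ?thesis
    by (simp add: cmod_def)
qed

text \<open>If the norm fell below \<open>p + q\<close>, adding
  \<open>(k - p) *\<^sub>R u + (k - q) *\<^sub>R v\<close> with \<open>k = max p q\<close> would
  force the norm of \<open>k *\<^sub>R (u + v)\<close> below \<open>2 * k\<close>.\<close>

lemma norm_nonneg_combination:
  fixes u v :: "'b::real_normed_vector"
  assumes u: "norm u \<le> 1" and v: "norm v \<le> 1" and uv: "norm (u + v) = 2"
    and p: "0 \<le> p" and q: "0 \<le> q"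
  shows "norm (p *\<^sub>R u + q *\<^sub>R v) = p + q"
proof (rule antisym)
  have "norm (p *\<^sub>R u + q *\<^sub>R v) \<le> p * norm u + q * norm v"
    using norm_triangle_ineq[of "p *\<^sub>R u" "q *\<^sub>R v"] p q by simp
  also have "\<dots> \<le> p + q"
    using mult_left_mono[OF u p] mult_left_mono[OF v q] by simp
  finally show "norm (p *\<^sub>R u + q *\<^sub>R v) \<le> p + q" .
next
  define k where "k = max p q"
  have k: "p \<le> k" "q \<le> k"
    by (auto simp: k_def)
  have "k *\<^sub>R (u + v) = (p *\<^sub>R u + q *\<^sub>R v) + ((k - p) *\<^sub>R u + (k - q) *\<^sub>R v)"
    by (simp add: algebra_simps)
  then have "norm (k *\<^sub>R (u + v)) \<le> norm (p *\<^sub>R u + q *\<^sub>R v) + (norm ((k - p) *\<^sub>R u) + norm ((k - q) *\<^sub>R v))"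
    using norm_triangle_ineq norm_triangle_le add_left_mono by metis
  also have "\<dots> \<le> norm (p *\<^sub>R u + q *\<^sub>R v) + ((k - p) + (k - q))"
    using mult_left_mono[OF u, of "k - p"] mult_left_mono[OF v, of "k - q"] k by simp
  finally show "p + q \<le> norm (p *\<^sub>R u + q *\<^sub>R v)"
    using uv k p by simp
qed

text \<open>The squared distances of \<mu> to 1 and -1 are 2 - 2c and 2 + 2c with c = Re \<mu>, so
  at least one exceeds 1; likewise for the imaginary axis. Comparing squares makes the coordinates
  of z at least as large in modulus as those of \<mu>, with matching signs, and
  \<open>cmod z \<le> 1\<close> leaves only equality.\<close>

lemma eq_if_cmod_diff_ge:
  assumes z: "cmod z \<le> 1" and \<mu>: "cmod \<mu> = 1"
    and far: "\<And>\<epsilon>. \<lbrakk>\<epsilon> \<in> {1, -1, \<i>, -\<i>}; cmod (\<mu> - \<epsilon>) > 1\<rbrakk> \<Longrightarrow> cmod (z - \<epsilon>) \<ge> cmod (\<mu> - \<epsilon>)"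
  shows "z = \<mu>"
proof -
  obtain a b where zab: "z = Complex a b" by (cases z)
  obtain c d where mcd: "\<mu> = Complex c d" by (cases \<mu>)
  have ab: "a\<^sup>2 + b\<^sup>2 \<le> 1"
    using z by (simp add: zab cmod_def)
  have cd: "c\<^sup>2 + d\<^sup>2 = 1"
    using \<mu> by (simp add: mcd cmod_def)
  have *: "(cmod (\<mu> - \<epsilon>))\<^sup>2 \<le> (cmod (z - \<epsilon>))\<^sup>2"
    if "\<epsilon> \<in> {1, -1, \<i>, -\<i>}" "(cmod (\<mu> - \<epsilon>))\<^sup>2 > 1" for \<epsilon>
  proof -
    have "cmod (\<mu> - \<epsilon>) > 1"
      using that(2) power_le_one[of "cmod (\<mu> - \<epsilon>)" 2] by force
    then show ?thesis
      using far that(1) by (intro power_mono) auto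
  qed
  have 1: "c \<le> 0 \<Longrightarrow> 2 * a \<le> 2 * c - (1 - a\<^sup>2 - b\<^sup>2)"
    using *[of 1] ab cd unfolding cmod_power2 by (simp add: zab mcd power2_eq_square algebra_simps; linarith)
  have 2: "c \<ge> 0 \<Longrightarrow> 2 * a \<ge> 2 * c + (1 - a\<^sup>2 - b\<^sup>2)"
    using *[of "-1"] ab cd unfolding cmod_power2 by (simp add: zab mcd power2_eq_square algebra_simps; linarith)
  have 3: "d \<le> 0 \<Longrightarrow> 2 * b \<le> 2 * d - (1 - a\<^sup>2 - b\<^sup>2)"
    using *[of \<i>] ab cd unfolding cmod_power2 by (simp add: zab mcd power2_eq_square algebra_simps; linarith)
  have 4: "d \<ge> 0 \<Longrightarrow> 2 * b \<ge> 2 * d + (1 - a\<^sup>2 - b\<^sup>2)"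
    using *[of "-\<i>"] ab cd unfolding cmod_power2 by (simp add: zab mcd power2_eq_square algebra_simps; linarith)
  have ac: "\<bar>c\<bar> \<le> \<bar>a\<bar>" and bd: "\<bar>d\<bar> \<le> \<bar>b\<bar>"
    using 1 2 3 4 ab by linarith+
  then have "c\<^sup>2 \<le> a\<^sup>2" "d\<^sup>2 \<le> b\<^sup>2"
    by (simp_all add: abs_le_square_iff)
  then have "c\<^sup>2 = a\<^sup>2" "d\<^sup>2 = b\<^sup>2"
    using ab cd by linarith+
  then have "a = c" "b = d"
    using 1 2 3 4 ab cd unfolding power2_eq_iff by (smt (verit))+
  then show ?thesis
    by (simp add: zab mcd)
qed

lemma cmod_diff_eq_two_imp:
  assumes z: "cmod z \<le> 1" and l: "cmod l = 1" and zl: "cmod (z - l) \<ge> 2"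
  shows "z = - l"
proof -
  have "(cmod (z - l))\<^sup>2 + (cmod (z + l))\<^sup>2 = 2 * (cmod z)\<^sup>2 + 2 * (cmod l)\<^sup>2"
    unfolding cmod_power2 by (simp add: power2_eq_square algebra_simps)
  moreover have "(cmod z)\<^sup>2 \<le> 1"
    using z by (simp add: power_le_one)
  moreover have "(cmod (z - l))\<^sup>2 \<ge> 4"
    using power_mono[OF zl, of 2] by simp
  moreover have "(cmod l)\<^sup>2 = 1"
    by (simp add: l)
  ultimately have "(cmod (z + l))\<^sup>2 \<le> 0"
    by linarith
  then show ?thesis
    by (simp add: eq_neg_iff_add_eq_0)
qed

subsection \<open>Busemann functions of faces\<close>

text \<open>
  \<open>busemann C\<close> replaces the norm-one functional that equals \<open>1\<close> on the convex subset \<open>C\<close> of the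
  sphere. It is only sublinear, but needs no Hahn-Banach theorem.
\<close>

definition busemann :: "'b::real_normed_vector set \<Rightarrow> 'b \<Rightarrow> real"
  where "busemann C x = (INF (n, y)\<in>{0..} \<times> C. norm (x + n *\<^sub>R y) - n)"

locale complex_sphere_face = complex_banach_space scaleC
  for scaleC :: "complex \<Rightarrow> 'b::banach \<Rightarrow> 'b" +
  fixes C :: "'b set"
  assumes nonempty: "C \<noteq> {}"
    and convex: "convex C"
    and subset_sphere: "C \<subseteq> sphere 0 1"
begin

lemma busemann_le:
  assumes "0 \<le> n" "y \<in> C"
  shows "busemann C x \<le> norm (x + n *\<^sub>R y) - n"
proof -
  \<comment> \<open>This lower bound makes the real infimum meaningful; it holds because all points
    of \<open>C\<close> have norm 1.\<close>
  have "- norm x \<le> norm (x + m *\<^sub>R v) - m" if "0 \<le> m" "v \<in> C" for m v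
    using norm_triangle_ineq2[of "m *\<^sub>R v" "- x"] subset_sphere that by (auto simp: add.commute)
  then have "bdd_below ((\<lambda>(n, y). norm (x + n *\<^sub>R y) - n) ` ({0..} \<times> C))"
    by (intro bdd_belowI2[of _ "- norm x"]) auto
  then show ?thesis
    unfolding busemann_def using assms by (intro cINF_lower2[where x = "(n, y)"]) auto
qed

lemma busemann_ge:
  assumes "\<And>n y. \<lbrakk>0 \<le> n; y \<in> C\<rbrakk> \<Longrightarrow> r \<le> norm (x + n *\<^sub>R y) - n"
  shows "r \<le> busemann C x"
  unfolding busemann_def using assms nonempty by (intro cINF_greatest) auto

lemma busemann_le_norm: "busemann C x \<le> norm x"
  using nonempty busemann_le[of 0] by fastforce

lemma busemann_zero: "busemann C 0 = 0"
proof (rule antisym)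
  show "busemann C 0 \<le> 0"
    using busemann_le_norm[of 0] by simp
  show "0 \<le> busemann C 0"
    by (rule busemann_ge) (use subset_sphere in auto)
qed

text \<open>Convexity of \<open>C\<close> enters here:
  \<open>n *\<^sub>R y + n' *\<^sub>R y'\<close> is again \<open>n + n'\<close> times a point of
  \<open>C\<close>, so one term of the infimum dominates the sum of two.\<close>

lemma busemann_add_le: "busemann C (x + x') \<le> busemann C x + busemann C x'"
proof -
  have *: "busemann C (x + x') - (norm (x' + n' *\<^sub>R y') - n') \<le> norm (x + n *\<^sub>R y) - n"
    if n: "0 \<le> n" "y \<in> C" "0 \<le> n'" "y' \<in> C" for n y n' y'
  proof (cases "n + n' = 0")
    case True
    then have "n = 0" "n' = 0" using n by auto
    then show ?thesis
      using busemann_le_norm[of "x + x'"] norm_triangle_ineq[of x x'] by simp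
  next
    case False
    define v where "v = (n / (n + n')) *\<^sub>R y + (n' / (n + n')) *\<^sub>R y'"
    have "v \<in> C"
      unfolding v_def using False n
      by (intro convexD[OF convex]) (auto simp flip: add_divide_distrib)
    moreover have "(n + n') *\<^sub>R v = n *\<^sub>R y + n' *\<^sub>R y'"
      using False by (simp add: v_def scaleR_add_right)
    ultimately have "busemann C (x + x') \<le> norm (x + x' + (n *\<^sub>R y + n' *\<^sub>R y')) - (n + n')"
      using busemann_le[of "n + n'" v "x + x'"] n by simp
    also have "norm (x + x' + (n *\<^sub>R y + n' *\<^sub>R y')) \<le> norm (x + n *\<^sub>R y) + norm (x' + n' *\<^sub>R y')"
      using norm_triangle_ineq[of "x + n *\<^sub>R y" "x' + n' *\<^sub>R y'"] by (simp add: algebra_simps)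
    finally show ?thesis by simp
  qed
  have "busemann C (x + x') - busemann C x \<le> busemann C x'"
  proof (rule busemann_ge)
    fix n' y' assume n': "(0::real) \<le> n'" "y' \<in> C"
    have "busemann C (x + x') - (norm (x' + n' *\<^sub>R y') - n') \<le> busemann C x"
      by (rule busemann_ge) (use * n' in blast)
    then show "busemann C (x + x') - busemann C x \<le> norm (x' + n' *\<^sub>R y') - n'"
      by simp
  qed
  then show ?thesis by simp
qed

lemma busemann_scaleR_le:
  assumes "0 < r"
  shows "busemann C (r *\<^sub>R x) \<le> r * busemann C x"
proof -
  have "busemann C (r *\<^sub>R x) / r \<le> busemann C x"
  proof (rule busemann_ge)
    fix n y assume n: "(0::real) \<le> n" "y \<in> C"
    have "busemann C (r *\<^sub>R x) \<le> norm (r *\<^sub>R x + (r * n) *\<^sub>R y) - r * n"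
      using assms n by (intro busemann_le) auto
    also have "r *\<^sub>R x + (r * n) *\<^sub>R y = r *\<^sub>R (x + n *\<^sub>R y)"
      by (simp add: scaleR_add_right)
    also have "norm (r *\<^sub>R (x + n *\<^sub>R y)) - r * n = r * (norm (x + n *\<^sub>R y) - n)"
      using assms by (simp add: right_diff_distrib)
    finally show "busemann C (r *\<^sub>R x) / r \<le> norm (x + n *\<^sub>R y) - n"
      using assms by (simp add: pos_divide_le_eq mult.commute)
  qed
  then show ?thesis
    using assms by (simp add: field_simps)
qed

lemma busemann_scaleR:
  assumes "0 \<le> r"
  shows "busemann C (r *\<^sub>R x) = r * busemann C x"
proof (cases "r = 0")
  case True
  then show ?thesis by (simp add: busemann_zero)
next
  case False
  then have r: "0 < r" using assms by simp
  have "busemann C ((1 / r) *\<^sub>R r *\<^sub>R x) \<le> (1 / r) * busemann C (r *\<^sub>R x)"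
    using r by (intro busemann_scaleR_le) simp
  then have "r * busemann C x \<le> busemann C (r *\<^sub>R x)"
    using r by (simp add: field_simps)
  then show ?thesis
    using busemann_scaleR_le[OF r] by (intro antisym)
qed

text \<open>Moving along the ray through \<open>y\<close> itself turns the norms into moduli of
  complex numbers, which gives the upper bound in the limit. The lower bound is the upper one for
  -\<mu>, by sublinearity.\<close>

lemma busemann_face:
  assumes y: "y \<in> C"
  shows "busemann C (scaleC \<mu> y) = Re \<mu>"
proof -
  have *: "busemann C (scaleC \<nu> y) \<le> Re \<nu>" for \<nu>
  proof (rule tendsto_lowerbound[OF tendsto_cmod_add_real_minus])
    show "\<forall>\<^sub>F n in at_top. busemann C (scaleC \<nu> y) \<le> cmod (\<nu> + of_real n) - n"
      using eventually_ge_at_top[of 0]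
    proof eventually_elim
      case (elim n)
      have "busemann C (scaleC \<nu> y) \<le> norm (scaleC \<nu> y + n *\<^sub>R y) - n"
        using elim y by (rule busemann_le)
      also have "scaleC \<nu> y + n *\<^sub>R y = scaleC (\<nu> + of_real n) y"
        by (simp add: scale_left_distrib scaleC_of_real)
      finally show ?case
        using y subset_sphere by (auto simp: norm_scaleC)
    qed
  qed simp
  have "0 \<le> busemann C (scaleC \<mu> y) + busemann C (scaleC (- \<mu>) y)"
    using busemann_add_le[of "scaleC \<mu> y" "scaleC (- \<mu>) y"] by (simp add: busemann_zero)
  then show ?thesis
    using *[of \<mu>] *[of "- \<mu>"] by simp
qed

text \<open>The Busemann function has the same value at \<mu> u and \<mu> u', so it sees only the
  scalars, and it is dominated by the norm.\<close>

lemma norm_diff_rotated_face_ge: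
  assumes u: "u \<in> C" "u' \<in> C"
  shows "cmod (\<zeta> - \<zeta>') \<le> norm (scaleC \<zeta> u - scaleC \<zeta>' u')"
proof (cases "\<zeta> = \<zeta>'")
  case False
  \<comment> \<open>This \<mu> rotates \<zeta> - \<zeta>' onto the positive real axis, where the
    real part loses nothing.\<close>
  define \<mu> where "\<mu> = cnj (\<zeta> - \<zeta>') / of_real (cmod (\<zeta> - \<zeta>'))"
  have \<mu>: "cmod \<mu> = 1"
    using False by (simp add: \<mu>_def norm_divide del: complex_cnj_diff)
  have "\<mu> * (\<zeta> - \<zeta>') = of_real (cmod (\<zeta> - \<zeta>'))"
    using False complex_norm_square[of "\<zeta> - \<zeta>'"]
    by (simp add: \<mu>_def field_simps power2_eq_square del: complex_cnj_diff)
  then have "cmod (\<zeta> - \<zeta>') = Re (\<mu> * \<zeta>) - Re (\<mu> * \<zeta>')"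
    by (metis Re_complex_of_real minus_complex.simps(1) right_diff_distrib)
  also have "\<dots> = busemann C (scaleC (\<mu> * \<zeta>) u) - busemann C (scaleC (\<mu> * \<zeta>') u')"
    using u by (simp add: busemann_face)
  also have "\<dots> \<le> busemann C (scaleC \<mu> (scaleC \<zeta> u - scaleC \<zeta>' u'))"
    using busemann_add_le[of "scaleC \<mu> (scaleC \<zeta> u - scaleC \<zeta>' u')" "scaleC (\<mu> * \<zeta>') u'"]
    by (simp add: scale_right_diff_distrib)
  also have "\<dots> \<le> norm (scaleC \<zeta> u - scaleC \<zeta>' u')"
    using busemann_le_norm[of "scaleC \<mu> (scaleC \<zeta> u - scaleC \<zeta>' u')"] \<mu> by (simp add: norm_scaleC)
  finally show ?thesis .
qed simp

text \<open>
  For a linear functional \<open>f\<close>, the hypotheses put \<open>f x\<close> into the closed discs of radius \<open>1 - r\<close> about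
  \<open>1\<close> and of radius \<open>1 + r\<close> about \<open>-1\<close>, which meet only in \<open>r\<close>.
\<close>

lemma busemann_tangent_discs:
  assumes y: "y \<in> C" "norm (x - y) \<le> 1 - r" and y': "y' \<in> C" "norm (x + y') \<le> 1 + r"
  shows "busemann C (scaleC z x) \<le> r * Re z"
proof -
  \<comment> \<open>Write z = (z + n) - n. The disc about -1 bounds the part z + n, the disc about 1
    bounds the part -n, and the sum of the two bounds is the expression in this limit.\<close>
  have lim: "((\<lambda>n. (1 + r) * (cmod (z + of_real n) - n) - Re z) \<longlongrightarrow> (1 + r) * Re z - Re z) at_top"
    by (intro tendsto_intros tendsto_cmod_add_real_minus)
  have "busemann C (scaleC z x) \<le> (1 + r) * Re z - Re z"
  proof (rule tendsto_lowerbound[OF lim])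
    show "\<forall>\<^sub>F n in at_top. busemann C (scaleC z x) \<le> (1 + r) * (cmod (z + of_real n) - n) - Re z"
      using eventually_ge_at_top[of 0]
    proof eventually_elim
      case (elim n)
      have "busemann C (scaleC (of_real n) (y - x) + scaleC (- of_real n) y)
          \<le> norm (scaleC (of_real n) (y - x)) - n"
        using busemann_add_le[of "scaleC (of_real n) (y - x)" "scaleC (- of_real n) y"]
          busemann_le_norm[of "scaleC (of_real n) (y - x)"] busemann_face[OF y(1), of "- of_real n"]
        by simp
      also have "scaleC (of_real n) (y - x) + scaleC (- of_real n) y = scaleC (- of_real n) x"
        by (simp add: scale_right_diff_distrib)
      also have "norm (scaleC (of_real n) (y - x)) \<le> n * (1 - r)"
        using y(2) elim by (simp add: norm_scaleC norm_minus_commute mult_left_mono)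
      finally have 1: "busemann C (scaleC (- of_real n) x) \<le> - (n * r)"
        by (simp add: algebra_simps)
      have "busemann C (scaleC (z + of_real n) (x + y') + scaleC (- (z + of_real n)) y')
          \<le> norm (scaleC (z + of_real n) (x + y')) - (Re z + n)"
        using busemann_add_le[of "scaleC (z + of_real n) (x + y')" "scaleC (- (z + of_real n)) y'"]
          busemann_le_norm[of "scaleC (z + of_real n) (x + y')"]
          busemann_face[OF y'(1), of "- (z + of_real n)"]
        by simp
      also have "scaleC (z + of_real n) (x + y') + scaleC (- (z + of_real n)) y' = scaleC (z + of_real n) x"
        unfolding scale_right_distrib scale_minus_left by simp
      also have "norm (scaleC (z + of_real n) (x + y')) \<le> cmod (z + of_real n) * (1 + r)"
        using y'(2) by (simp add: norm_scaleC mult_left_mono)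
      finally have 2: "busemann C (scaleC (z + of_real n) x) \<le> cmod (z + of_real n) * (1 + r) - (Re z + n)"
        by simp
      have "busemann C (scaleC z x) \<le> busemann C (scaleC (z + of_real n) x) + busemann C (scaleC (- of_real n) x)"
        using busemann_add_le[of "scaleC (z + of_real n) x" "scaleC (- of_real n) x"]
        by (simp add: scale_left_distrib)
      then show ?case
        using 1 2 by (simp add: algebra_simps)
    qed
  qed simp
  then show ?thesis
    by (simp add: algebra_simps)
qed

end

text \<open>Rotation by \<kappa> preserves norms and carries \<open>C\<close> into \<open>D\<close>,
  so the infimum on the left runs over at least as many values.\<close>

lemma (in complex_banach_space) busemann_rotate_le:
  assumes C: "complex_sphere_face scaleC C" and D: "complex_sphere_face scaleC D"
    and \<kappa>: "cmod \<kappa> = 1" and CD: "\<And>y. y \<in> C \<Longrightarrow> scaleC \<kappa> y \<in> D"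
  shows "busemann D (scaleC \<kappa> x) \<le> busemann C x"
proof (rule complex_sphere_face.busemann_ge[OF C])
  fix n y assume n: "(0::real) \<le> n" "y \<in> C"
  have "busemann D (scaleC \<kappa> x) \<le> norm (scaleC \<kappa> x + n *\<^sub>R scaleC \<kappa> y) - n"
    using n CD by (intro complex_sphere_face.busemann_le[OF D]) auto
  also have "scaleC \<kappa> x + n *\<^sub>R scaleC \<kappa> y = scaleC \<kappa> (x + n *\<^sub>R y)"
    by (simp add: scale_right_distrib mult.commute flip: scaleC_of_real)
  finally show "busemann D (scaleC \<kappa> x) \<le> norm (x + n *\<^sub>R y) - n"
    using \<kappa> by (simp add: norm_scaleC)
qed


subsection \<open>Faces of function spaces\<close>

text \<open>The assumption \<open>0 \<le> r\<close> serves the empty \<open>L\<close>, where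
  \<open>sup_norm\<close> is 0 by convention.\<close>

lemma sup_norm_le:
  assumes "\<And>t. t \<in> L \<Longrightarrow> cmod (a t) \<le> r" and "0 \<le> r"
  shows "sup_norm L a \<le> r"
  using assms by (auto simp: sup_norm_def intro: cSUP_least)

lemma less_sup_norm:
  assumes "r < sup_norm L a" "0 \<le> r"
  obtains t where "t \<in> L" "r < cmod (a t)"
  using assms sup_norm_le[of L a r] by fastforce

text \<open>
  Only these closure properties of \<open>C\<^sub>0\<^sup>T(L)\<close> are needed: multiplying by functions of a modulus
  makes separation arguments in \<open>L\<close> superfluous.
\<close>

locale modulus_module =
  fixes L :: "'a set" and E :: "('a \<Rightarrow> complex) set"
  assumes zero_outside: "\<lbrakk>a \<in> E; t \<notin> L\<rbrakk> \<Longrightarrow> a t = 0"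
    and bounded_above: "a \<in> E \<Longrightarrow> bdd_above ((\<lambda>t. cmod (a t)) ` L)"
    and zero_closed: "(\<lambda>t. 0) \<in> E"
    and add_closed: "\<lbrakk>a \<in> E; b \<in> E\<rbrakk> \<Longrightarrow> (\<lambda>t. a t + b t) \<in> E"
    and mult_closed: "a \<in> E \<Longrightarrow> (\<lambda>t. c * a t) \<in> E"
    and modulus_closed: "\<lbrakk>a \<in> E; f \<in> E; continuous_on UNIV k; bounded (range k)\<rbrakk>
        \<Longrightarrow> (\<lambda>t. of_real (k (cmod (f t))) * a t) \<in> E"
begin

lemma diff_closed:
  assumes "a \<in> E" "b \<in> E"
  shows "(\<lambda>t. a t - b t) \<in> E"
  using add_closed[OF assms(1) mult_closed[OF assms(2), of "-1"]] by simp

lemma uminus_closed: "a \<in> E \<Longrightarrow> (\<lambda>t. - a t) \<in> E"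
  using mult_closed[of a "-1"] by simp

lemma cmod_le_sup_norm:
  assumes "a \<in> E"
  shows "cmod (a t) \<le> sup_norm L a"
proof -
  have *: "cmod (a s) \<le> sup_norm L a" if "s \<in> L" for s
    using that cSUP_upper[OF that bounded_above[OF assms]] by (auto simp: sup_norm_def)
  then have "0 \<le> sup_norm L a"
    by (cases "L = {}") (auto simp: sup_norm_def intro: order_trans[OF norm_ge_zero])
  then show ?thesis
    using * zero_outside[OF assms, of t] by (cases "t \<in> L") auto
qed

lemma sup_norm_nonneg: "a \<in> E \<Longrightarrow> 0 \<le> sup_norm L a"
  using cmod_le_sup_norm norm_ge_zero order_trans by blast

lemma sup_norm_eq_0:
  assumes "a \<in> E" "sup_norm L a = 0"
  shows "a = (\<lambda>t. 0)"
  using cmod_le_sup_norm[OF assms(1)] assms(2) by fastforce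

lemma sup_norm_mult:
  assumes a: "a \<in> E"
  shows "sup_norm L (\<lambda>t. c * a t) = cmod c * sup_norm L a"
proof (rule antisym)
  show "sup_norm L (\<lambda>t. c * a t) \<le> cmod c * sup_norm L a"
    using a by (intro sup_norm_le) (auto simp: norm_mult mult_left_mono cmod_le_sup_norm sup_norm_nonneg)
  show "cmod c * sup_norm L a \<le> sup_norm L (\<lambda>t. c * a t)"
  proof (cases "c = 0")
    case True
    then show ?thesis
      using sup_norm_nonneg[OF mult_closed[OF a, of c]] by simp
  next
    case False
    have "sup_norm L a \<le> sup_norm L (\<lambda>t. c * a t) / cmod c"
      using cmod_le_sup_norm[OF mult_closed[OF a, of c]] sup_norm_nonneg[OF mult_closed[OF a, of c]] False
      by (intro sup_norm_le) (simp_all add: norm_mult field_simps)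
    then show ?thesis
      using False by (simp add: field_simps)
  qed
qed

definition unit_sphere :: "('a \<Rightarrow> complex) set"
  where "unit_sphere = {a \<in> E. sup_norm L a = 1}"

definition face :: "'a \<Rightarrow> complex \<Rightarrow> ('a \<Rightarrow> complex) set"
  where "face t l = {a \<in> unit_sphere. a t = l}"

lemma face_subset: "face t l \<subseteq> unit_sphere"
  by (auto simp: face_def)

lemma faceD:
  assumes "a \<in> face t l"
  shows "a \<in> E" "a t = l" "cmod (a s) \<le> 1"
  using assms cmod_le_sup_norm[of a s] by (auto simp: face_def unit_sphere_def)

lemma faceI:
  assumes "a \<in> E" "\<And>s. cmod (a s) \<le> 1" "a t = l" "cmod l = 1"
  shows "a \<in> face t l"
proof -
  have "sup_norm L a = 1"
    using assms sup_norm_le[of L a 1] cmod_le_sup_norm[of a t] by auto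
  then show ?thesis
    using assms by (simp add: face_def unit_sphere_def)
qed

lemma face_mult:
  assumes "a \<in> face t l" "cmod c = 1" "cmod l = 1"
  shows "(\<lambda>s. c * a s) \<in> face t (c * l)"
  using faceD[OF assms(1)] assms by (intro faceI mult_closed) (auto simp: norm_mult)

lemma face_uminus:
  assumes "a \<in> face t l" "cmod l = 1"
  shows "(\<lambda>s. - a s) \<in> face t (- l)"
  using face_mult[OF assms(1) _ assms(2), of "-1"] by simp

lemma face_nonempty_trans:
  assumes "face t l \<noteq> {}" "cmod l = 1" "cmod l' = 1"
  shows "face t l' \<noteq> {}"
proof -
  obtain a where "a \<in> face t l"
    using assms(1) by auto
  then have "(\<lambda>s. (l' / l) * a s) \<in> face t (l' / l * l)"
    using assms by (intro face_mult) (auto simp: norm_divide)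
  moreover have "l \<noteq> 0"
    using assms(2) by auto
  ultimately show ?thesis by auto
qed

text \<open>The factor is 1 at \<open>t\<close> and 0 wherever the modulus of \<open>f\<close> is at
  least \<open>d\<close>, so elements of a face can be concentrated where \<open>f\<close> is small.
  The inner absolute value keeps the profile bounded on negative arguments, as
  \<open>modulus_closed\<close> demands.\<close>

lemma face_bump:
  assumes a: "a \<in> face t l" and l: "cmod l = 1" and f: "f \<in> E" "f t = 0" and d: "0 < d"
  shows "(\<lambda>s. of_real (max 0 (1 - \<bar>cmod (f s)\<bar> / d)) * a s) \<in> face t l"
proof (rule faceI)
  show "(\<lambda>s. of_real (max 0 (1 - \<bar>cmod (f s)\<bar> / d)) * a s) \<in> E"
  proof (rule modulus_closed[where k = "\<lambda>r. max 0 (1 - \<bar>r\<bar> / d)"])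
    show "bounded (range (\<lambda>r. max 0 (1 - \<bar>r\<bar> / d)))"
      using d by (intro boundedI[of _ 1]) (auto simp: max_def)
  qed (use faceD[OF a] f d in \<open>auto intro!: continuous_intros\<close>)
  show "cmod (of_real (max 0 (1 - \<bar>cmod (f s)\<bar> / d)) * a s) \<le> 1" for s
    using mult_mono[of "max 0 (1 - \<bar>cmod (f s)\<bar> / d)" 1 "cmod (a s)" 1] faceD(3)[OF a] d
    by (simp add: norm_mult)
qed (use faceD[OF a] f l in auto)

section \<open>Nearest points in a face and in the antipodal face\<close>

lemma face_nearest:
  assumes a: "a \<in> E" "\<And>s. cmod (a s) \<le> 1" and at: "a t = of_real r * l" and r: "0 < r" and l: "cmod l = 1"
  shows "\<exists>b\<in>face t l. \<forall>s. cmod (a s - b s) \<le> 1 - r"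
proof (intro bexI allI)
  \<comment> \<open>Values of modulus at least \<open>r\<close> are pushed radially to the circle
    and smaller ones are stretched by \<open>1 / r\<close>; neither moves a value by more than
    \<open>1 - r\<close>.\<close>
  let ?k = "\<lambda>x::real. 1 / max x r"
  have ar: "cmod (a t) = r" "r \<le> 1"
    using a(2)[of t] r l by (auto simp: at norm_mult)
  show "(\<lambda>s. of_real (?k (cmod (a s))) * a s) \<in> face t l"
  proof (rule faceI)
    show "(\<lambda>s. of_real (?k (cmod (a s))) * a s) \<in> E"
    proof (rule modulus_closed[where k = ?k])
      show "bounded (range ?k)"
        using r by (intro boundedI[of _ "1 / r"]) (auto intro!: divide_left_mono)
    qed (use a r in \<open>auto intro!: continuous_intros\<close>)
    show "cmod (of_real (?k (cmod (a s))) * a s) \<le> 1" for s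
      unfolding norm_mult norm_of_real using r by (simp add: divide_le_eq)
  qed (use r ar at l in auto)
  show "cmod (a s - of_real (?k (cmod (a s))) * a s) \<le> 1 - r" for s
  proof -
    have "a s - of_real (?k (cmod (a s))) * a s = of_real (1 - ?k (cmod (a s))) * a s"
      by (simp add: algebra_simps)
    then have "cmod (a s - of_real (?k (cmod (a s))) * a s) = \<bar>1 - ?k (cmod (a s))\<bar> * cmod (a s)"
      by (metis norm_mult norm_of_real)
    also have "\<dots> \<le> 1 - r"
    proof (cases "r \<le> cmod (a s)")
      case True
      moreover have "1 \<le> 1 / cmod (a s)"
        using a(2)[of s] True r by (subst le_divide_eq_1_pos) auto
      then have "\<bar>1 - 1 / cmod (a s)\<bar> = 1 / cmod (a s) - 1"
        by linarith
      moreover have "a s \<noteq> 0"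
        using True r by auto
      ultimately show ?thesis
        using True by (simp add: left_diff_distrib)
    next
      case False
      moreover have "\<bar>1 - 1 / r\<bar> = 1 / r - 1"
        using r ar by simp
      moreover have "(1 / r - 1) * cmod (a s) \<le> (1 / r - 1) * r"
        using False r ar by (intro mult_left_mono) auto
      moreover have "(1 / r - 1) * r = 1 - r" "max (cmod (a s)) r = r"
        using False r by (auto simp: left_diff_distrib)
      ultimately show ?thesis
        by simp
    qed
    finally show ?thesis .
  qed
qed

lemma face_antipodal_nearest:
  assumes a: "a \<in> E" "\<And>s. cmod (a s) \<le> 1" and at: "a t = of_real r * l" and r: "0 < r" and l: "cmod l = 1"
  shows "\<exists>b\<in>face t (- l). \<forall>s. cmod (a s - b s) \<le> 1 + r"
proof (intro bexI allI)
  \<comment> \<open>A value of modulus at least \<open>r\<close> is moved by exactly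
    \<open>1 + r\<close> towards and past the origin; a smaller one is multiplied by
    \<open>- 1 / r\<close>. Modulus \<open>r\<close> is thus sent to the opposite point of the
    circle.\<close>
  let ?k = "\<lambda>x::real. 1 - (1 + r) / max x r"
  have ar: "cmod (a t) = r" "r \<le> 1"
    using a(2)[of t] r l by (auto simp: at norm_mult)
  have cases: "(cmod (a s) < r \<and> ?k (cmod (a s)) = - 1 / r)
      \<or> (r \<le> cmod (a s) \<and> ?k (cmod (a s)) * cmod (a s) = cmod (a s) - (1 + r))" for s
    using r by (cases "a s = 0") (auto simp: max_def field_simps)
  show "(\<lambda>s. of_real (?k (cmod (a s))) * a s) \<in> face t (- l)"
  proof (rule faceI)
    show "(\<lambda>s. of_real (?k (cmod (a s))) * a s) \<in> E"
    proof (rule modulus_closed[where k = ?k])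
      have "\<bar>?k x\<bar> \<le> 1 + (1 + r) / r" for x
      proof -
        have "0 \<le> (1 + r) / max x r" "(1 + r) / max x r \<le> (1 + r) / r"
          using r by (auto intro!: divide_left_mono)
        then show ?thesis by linarith
      qed
      then show "bounded (range ?k)"
        by (intro boundedI[of _ "1 + (1 + r) / r"]) auto
    qed (use a r in \<open>auto intro!: continuous_intros\<close>)
    show "cmod (of_real (?k (cmod (a s))) * a s) \<le> 1" for s
    proof -
      have "cmod (of_real (?k (cmod (a s))) * a s) = \<bar>?k (cmod (a s)) * cmod (a s)\<bar>"
        by (simp only: norm_mult norm_of_real abs_mult abs_norm_cancel)
      also have "\<dots> \<le> 1"
        using cases[of s]
      proof (elim disjE conjE)
        assume "cmod (a s) < r" "?k (cmod (a s)) = - 1 / r"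
        then show ?thesis
          using r by (simp only:) (simp add: divide_le_eq)
      next
        assume "r \<le> cmod (a s)" "?k (cmod (a s)) * cmod (a s) = cmod (a s) - (1 + r)"
        then show ?thesis
          using r a(2)[of s] by linarith
      qed
      finally show ?thesis .
    qed
    have "?k (cmod (a t)) * r = - 1"
      using ar(1) r by (simp add: field_simps)
    then have "of_real (?k (cmod (a t))) * of_real r = (- 1 :: complex)"
      by (metis of_real_1 of_real_minus of_real_mult)
    then show "of_real (?k (cmod (a t))) * a t = - l"
      unfolding at by (simp only: mult.assoc[symmetric]) simp
  qed (use l in auto)
  show "cmod (a s - of_real (?k (cmod (a s))) * a s) \<le> 1 + r" for s
  proof -
    have "a s - of_real (?k (cmod (a s))) * a s = of_real ((1 + r) / max (cmod (a s)) r) * a s"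
      by (simp add: algebra_simps)
    then have "cmod (a s - of_real (?k (cmod (a s))) * a s) = \<bar>(1 + r) / max (cmod (a s)) r\<bar> * cmod (a s)"
      by (metis norm_mult norm_of_real)
    also have "\<dots> = (1 + r) * (cmod (a s) / max (cmod (a s)) r)"
      using r by simp
    also have "\<dots> \<le> (1 + r) * 1"
      using r by (intro mult_left_mono) (auto simp: divide_le_eq)
    also have "\<dots> = 1 + r"
      by simp
    finally show ?thesis .
  qed
qed

text \<open>For r = 0 the radial profiles above would divide by zero and \<open>a t\<close> has no
  direction. Instead a given element of the face is damped so that its modulus is at most
  \<open>1 - cmod (a s)\<close>.\<close>

lemma face_nearest_zero:
  assumes a: "a \<in> E" "\<And>s. cmod (a s) \<le> 1" and at: "a t = 0" and l: "cmod l = 1" and ne: "face t l \<noteq> {}"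
  shows "\<exists>b\<in>face t l. \<forall>s. cmod (a s - b s) \<le> 1"
proof -
  obtain u where u: "u \<in> face t l"
    using ne by auto
  let ?b = "\<lambda>s. of_real (max 0 (1 - \<bar>cmod (a s)\<bar> / 1)) * u s"
  have "?b \<in> face t l"
    by (rule face_bump) (use u l a at in auto)
  moreover have "cmod (a s - ?b s) \<le> 1" for s
  proof -
    have "cmod (?b s) = \<bar>max 0 (1 - \<bar>cmod (a s)\<bar> / 1)\<bar> * cmod (u s)"
      by (simp only: norm_mult norm_of_real)
    also have "\<dots> = (1 - cmod (a s)) * cmod (u s)"
      using a(2)[of s] by simp
    also have "\<dots> \<le> 1 - cmod (a s)"
      using faceD(3)[OF u, of s] a(2)[of s] by (simp add: mult_left_le)
    finally show ?thesis
      using norm_triangle_ineq4[of "a s" "?b s"] by linarith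
  qed
  ultimately show ?thesis
    by (intro bexI[of _ ?b] allI)
qed

section \<open>Reading the value at a point from distances to a face\<close>

text \<open>Choose \<open>a\<close> supported where \<open>f\<close> and \<open>g = c - z u\<close>
  are small. There \<open>c - a\<close> is close to (z - \<kappa>) u with \<kappa> in [0,1], and z -
  \<kappa> is a convex combination of z and z - 1, of moduli at most 1 and equal to
  \<open>cmod (c t - l)\<close>. Off the support only \<open>c\<close> is left, of modulus at most
  1; hence \<rho> > 1 is required. The function \<open>f\<close> allows \<open>far\<close> to be
  known for narrowly supported \<open>a\<close> only.\<close>

lemma peak_bound:
  assumes c: "c \<in> E" "\<And>s. cmod (c s) \<le> 1" and u: "u \<in> face t l" and l: "cmod l = 1"
    and f: "f \<in> E" "f t = 0" and \<rho>: "1 < \<rho>"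
    and far: "\<And>d a. \<lbrakk>0 < d; a \<in> face t l; \<And>s. d \<le> cmod (f s) \<Longrightarrow> a s = 0\<rbrakk>
        \<Longrightarrow> \<rho> - 8 * d \<le> sup_norm L (\<lambda>s. c s - a s)"
  shows "\<rho> \<le> cmod (c t - l)"
proof (rule ccontr)
  assume "\<not> \<rho> \<le> cmod (c t - l)"
  \<comment> \<open>The gap of 10 d pays for 8 d in \<open>far\<close>, one d to pass from the
    supremum to a point, and one d for the size of \<open>g\<close>.\<close>
  define d where "d = (\<rho> - max 1 (cmod (c t - l))) / 10"
  have "10 * d = \<rho> - max 1 (cmod (c t - l))"
    by (simp add: d_def)
  then have d: "0 < d" "1 \<le> \<rho> - 10 * d" "cmod (c t - l) \<le> \<rho> - 10 * d"
    using \<open>\<not> \<rho> \<le> cmod (c t - l)\<close> \<rho> by linarith+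
  define z where "z = c t * cnj l"
  define g where "g s = c s - z * u s" for s
  have ll: "l * cnj l = 1"
    using l by (simp add: complex_norm_square[symmetric])
  have g: "g \<in> E" "g t = 0"
    using c(1) faceD[OF u] ll unfolding g_def by (auto intro!: diff_closed mult_closed simp: z_def mult_ac)
  let ?h = "\<lambda>f s. max 0 (1 - \<bar>cmod (f s)\<bar> / d)"
  define \<kappa> where "\<kappa> s = ?h f s * ?h g s" for s
  define a where "a s = of_real (?h f s) * (of_real (?h g s) * u s)" for s
  have a_eq: "a s = of_real (\<kappa> s) * u s" for s
    by (simp add: a_def \<kappa>_def)
  have "(\<lambda>s. of_real (?h g s) * u s) \<in> face t l"
    by (rule face_bump) (use u l g d in auto)
  then have a: "a \<in> face t l"
    unfolding a_def by (rule face_bump) (use l f d in auto)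
  have h: "0 \<le> ?h q s" "?h q s \<le> 1" for q s
    using d by auto
  have \<kappa>: "0 \<le> \<kappa> s" "\<kappa> s \<le> 1" for s
    unfolding \<kappa>_def by (intro mult_nonneg_nonneg mult_le_one h)+
  have "\<rho> - 8 * d \<le> sup_norm L (\<lambda>s. c s - a s)"
    using d(1) a by (rule far) (use d(1) in \<open>simp add: a_def\<close>)
  then have "\<rho> - 9 * d < sup_norm L (\<lambda>s. c s - a s)"
    using d by linarith
  then obtain s where s: "\<rho> - 9 * d < cmod (c s - a s)"
    using d by (elim less_sup_norm) auto
  then have "a s \<noteq> 0"
    using c(2)[of s] d by auto
  then have "cmod (g s) < d"
    using d by (auto simp: a_def max_def split: if_splits)
  have "z - 1 = (c t - l) * cnj l"
    using ll by (simp add: z_def algebra_simps)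
  then have z1: "cmod (z - 1) \<le> \<rho> - 10 * d"
    using d l by (simp add: norm_mult)
  have z: "cmod z \<le> 1"
    using c(2)[of t] l by (simp add: z_def norm_mult)
  have "z - of_real (\<kappa> s) = of_real (1 - \<kappa> s) * z + of_real (\<kappa> s) * (z - 1)"
    by (simp add: algebra_simps)
  then have "cmod (z - of_real (\<kappa> s)) \<le> (1 - \<kappa> s) * cmod z + \<kappa> s * cmod (z - 1)"
    using norm_triangle_ineq[of "of_real (1 - \<kappa> s) * z" "of_real (\<kappa> s) * (z - 1)"] \<kappa>[of s]
    by (simp add: norm_mult del: of_real_diff)
  also have "\<dots> \<le> (1 - \<kappa> s) * (\<rho> - 10 * d) + \<kappa> s * (\<rho> - 10 * d)"
    using \<kappa>[of s] z z1 d by (intro add_mono mult_left_mono) auto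
  also have "\<dots> = \<rho> - 10 * d"
    by (simp add: algebra_simps)
  finally have "cmod ((z - of_real (\<kappa> s)) * u s) \<le> \<rho> - 10 * d"
    using faceD(3)[OF u, of s] mult_mono[of _ "\<rho> - 10 * d" "cmod (u s)" 1] d by (simp add: norm_mult)
  moreover have "c s - a s = g s + (z - of_real (\<kappa> s)) * u s"
    by (simp add: g_def a_eq algebra_simps)
  then have "cmod (c s - a s) \<le> cmod (g s) + cmod ((z - of_real (\<kappa> s)) * u s)"
    by (simp only: norm_triangle_ineq)
  ultimately have "cmod (c s - a s) \<le> d + (\<rho> - 10 * d)"
    using \<open>cmod (g s) < d\<close> by linarith
  with s show False by simp
qed

lemma peak_bound_simple:
  assumes "c \<in> E" "\<And>s. cmod (c s) \<le> 1" and ne: "face t l \<noteq> {}" and "cmod l = 1" "1 < \<rho>"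
    and far: "\<And>a. a \<in> face t l \<Longrightarrow> \<rho> \<le> sup_norm L (\<lambda>s. c s - a s)"
  shows "\<rho> \<le> cmod (c t - l)"
proof -
  obtain u where u: "u \<in> face t l"
    using ne by auto
  show ?thesis
  \<comment> \<open>With f = 0 the support condition is empty; the form \<open>0 * u s\<close> gets
    membership in \<open>E\<close> from \<open>mult_closed\<close>.\<close>
  proof (rule peak_bound[where f = "\<lambda>s. 0 * u s"])
    show "\<rho> - 8 * d \<le> sup_norm L (\<lambda>s. c s - a s)" if "0 < d" "a \<in> face t l" for d a
      using far[OF that(2)] that(1) by linarith
  qed (use assms u mult_closed[OF faceD(1)[OF u], of 0] in auto)
qed

end


subsection \<open>Isometries of spheres\<close>

locale sphere_isometry = modulus_module L E + complex_banach_space scaleX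
  for L :: "'a set" and E :: "('a \<Rightarrow> complex) set" and scaleX :: "complex \<Rightarrow> 'b::banach \<Rightarrow> 'b" +
  fixes \<Delta> :: "('a \<Rightarrow> complex) \<Rightarrow> 'b"
  assumes isometry: "\<lbrakk>a \<in> unit_sphere; b \<in> unit_sphere\<rbrakk>
        \<Longrightarrow> norm (\<Delta> a - \<Delta> b) = sup_norm L (\<lambda>t. a t - b t)"
    and image_sphere: "\<Delta> ` unit_sphere = sphere 0 1"
begin

lemma norm_image: "a \<in> unit_sphere \<Longrightarrow> norm (\<Delta> a) = 1"
  using image_sphere by auto

lemma obtain_preimage:
  assumes "norm x = 1"
  obtains a where "a \<in> E" "\<And>s. cmod (a s) \<le> 1" "a \<in> unit_sphere" "\<Delta> a = x"
proof -
  have "x \<in> \<Delta> ` unit_sphere"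
    using assms by (simp add: image_sphere)
  then obtain a where "a \<in> unit_sphere" "\<Delta> a = x"
    by auto
  then show thesis
    using that cmod_le_sup_norm[of a] by (auto simp: unit_sphere_def)
qed

lemma inj_on_image: "inj_on \<Delta> unit_sphere"
proof (rule inj_onI)
  fix a b assume ab: "a \<in> unit_sphere" "b \<in> unit_sphere" "\<Delta> a = \<Delta> b"
  then have "(\<lambda>t. a t - b t) = (\<lambda>t. 0)"
    using isometry[OF ab(1,2)] by (intro sup_norm_eq_0 diff_closed) (auto simp: unit_sphere_def)
  then show "a = b"
    by (simp add: fun_eq_iff)
qed

lemma image_face_eqD:
  assumes "\<Delta> a \<in> \<Delta> ` face t l" "a \<in> unit_sphere"
  shows "a t = l"
  using assms inj_on_image by (auto simp: face_def inj_on_def)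

section \<open>Convexity of the images of faces\<close>

text \<open>
  The point \<open>d\<close> below is at distance \<open>2\<close> from \<open>a\<^sub>1\<close> and at distance at most \<open>1/2\<close> from \<open>-a\<close>, so it
  is nearly equal to \<open>- a\<^sub>1\<close> at some point where \<open>a\<close> does not vanish, that is, where \<open>a\<^sub>1\<close> and
  \<open>a\<^sub>2\<close> are close to each other.
\<close>

lemma norm_face_sum_ge:
  assumes a1: "a1 \<in> face t l" and a2: "a2 \<in> face t l" and l: "cmod l = 1" and a: "a \<in> face t l"
    and \<delta>: "0 < \<delta>" "\<delta> \<le> 1 / 2" and zero: "\<And>s. \<delta> \<le> cmod (a1 s - a2 s) \<Longrightarrow> a s = 0"
  shows "2 - 2 * \<delta> \<le> norm (\<Delta> a2 + ((1/4) *\<^sub>R \<Delta> a1 + (3/4) *\<^sub>R (- \<Delta> (\<lambda>s. - a s))))"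
proof -
  \<comment> \<open>At this stage nothing relates \<Delta> (-a) to -\<Delta> a, so \<open>w\<close>
    stands in for the image of \<open>a\<close>.\<close>
  define w where "w = - \<Delta> (\<lambda>s. - a s)"
  have S: "a1 \<in> unit_sphere" "a2 \<in> unit_sphere" "(\<lambda>s. - a s) \<in> unit_sphere"
    using a1 a2 face_uminus[OF a l] face_subset by auto
  note a1' = faceD[OF a1] and a' = faceD[OF a]
  have n: "norm (\<Delta> a1) = 1" "norm w = 1"
    using S by (simp_all add: norm_image w_def)
  have "norm (\<Delta> a1 + w) = sup_norm L (\<lambda>s. a1 s - - a s)"
    using isometry[OF S(1,3)] by (simp add: w_def)
  also have "\<dots> \<ge> cmod (a1 t - - a t)"
    using a1' uminus_closed[OF a'(1)] by (intro cmod_le_sup_norm[where a = "\<lambda>s. a1 s - - a s"] diff_closed) auto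
  finally have "norm (\<Delta> a1 + w) \<ge> 2"
    using a1'(2) a'(2) l by (simp add: norm_mult flip: mult_2)
  then have y1w: "norm (\<Delta> a1 + w) = 2"
    using norm_triangle_ineq[of "\<Delta> a1" w] n by simp
  \<comment> \<open>The weight 3/4 keeps \<open>m\<close> within 1/2 of \<open>w\<close>. Since
    \<open>d\<close> will have modulus above 1 - \<delta> \<ge> 1/2 at the chosen point,
    \<open>a\<close> cannot vanish there.\<close>
  define m where "m = (1/4) *\<^sub>R \<Delta> a1 + (3/4) *\<^sub>R w"
  have "norm m = 1"
    unfolding m_def using norm_nonneg_combination[of "\<Delta> a1" w "1/4" "3/4"] n y1w by simp
  then obtain d where d: "d \<in> E" "\<And>s. cmod (d s) \<le> 1" "d \<in> unit_sphere" "\<Delta> d = - m"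
    using obtain_preimage[of "- m"] by auto
  have "sup_norm L (\<lambda>s. d s - - a s) = norm (- m + w)"
    using isometry[OF d(3) S(3)] by (simp add: d w_def)
  also have "- m + w = (1/4) *\<^sub>R (w - \<Delta> a1)"
    by (simp add: m_def algebra_simps flip: scaleR_add_left)
  also have "norm \<dots> \<le> 1/2"
    using norm_triangle_ineq4[of w "\<Delta> a1"] n by simp
  finally have da: "cmod (d s + a s) \<le> 1/2" for s
    using cmod_le_sup_norm[OF diff_closed[OF d(1) uminus_closed[OF a'(1)]], of s] by simp
  have "sup_norm L (\<lambda>s. d s - a1 s) = norm (- (m + \<Delta> a1))"
    using isometry[OF d(3) S(1)] by (simp add: d)
  also have "m + \<Delta> a1 = (5/4) *\<^sub>R \<Delta> a1 + (3/4) *\<^sub>R w"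
    using scaleR_left_distrib[of 1 "1/4" "\<Delta> a1"] by (simp add: m_def)
  also have "norm (- \<dots>) = 2"
    using norm_nonneg_combination[of "\<Delta> a1" w "5/4" "3/4"] n y1w unfolding norm_minus_cancel by simp
  finally obtain s where s: "2 - \<delta> < cmod (d s - a1 s)"
    using \<delta> less_sup_norm[of "2 - \<delta>" L "\<lambda>s. d s - a1 s"] by auto
  then have "1/2 < cmod (d s)"
    using norm_triangle_ineq4[of "d s" "a1 s"] a1'(3)[of s] \<delta> by linarith
  then have "a s \<noteq> 0"
    using da[of s] by auto
  then have "cmod (a1 s - a2 s) < \<delta>"
    using zero[of s] by force
  then have "2 - 2 * \<delta> \<le> cmod (d s - a2 s)"
    using s norm_triangle_ineq[of "d s - a2 s" "a2 s - a1 s"] norm_minus_commute[of "a1 s" "a2 s"] by simp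
  also have "\<dots> \<le> sup_norm L (\<lambda>s. d s - a2 s)"
    using d(1) faceD(1)[OF a2] by (intro cmod_le_sup_norm[where a = "\<lambda>s. d s - a2 s"] diff_closed)
  also have "\<dots> = norm (\<Delta> d - \<Delta> a2)"
    using isometry[OF d(3) S(2)] by simp
  also have "\<Delta> d - \<Delta> a2 = - (\<Delta> a2 + m)"
    by (simp add: d)
  finally show ?thesis
    by (simp only: norm_minus_cancel m_def w_def)
qed

text \<open>A convex combination \<open>m\<close> of two image points is almost at distance 2 from
  \<Delta> (-b) for every \<open>b\<close> in the face supported where the two preimages nearly
  agree. This forces norm 1, and \<open>peak_bound\<close> places the preimage of \<open>m\<close>
  in the face.\<close>

lemma convex_image_face:
  assumes l: "cmod l = 1"
  shows "convex (\<Delta> ` face t l)"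
proof (rule convexI)
  fix y1 y2 p q
  assume y: "y1 \<in> \<Delta> ` face t l" "y2 \<in> \<Delta> ` face t l" and pq: "0 \<le> p" "0 \<le> q" "p + q = (1::real)"
  obtain a1 a2 where a: "a1 \<in> face t l" "a2 \<in> face t l" "y1 = \<Delta> a1" "y2 = \<Delta> a2"
    using y by auto
  define m where "m = p *\<^sub>R y1 + q *\<^sub>R y2"
  define f where "f s = a1 s - a2 s" for s
  have f: "f \<in> E" "f t = 0"
    using faceD[OF a(1)] faceD[OF a(2)] unfolding f_def by (auto intro: diff_closed)
  have n: "norm y1 = 1" "norm y2 = 1"
    using a norm_image face_subset by auto
  have key: "2 - 8 * d \<le> norm (m - \<Delta> (\<lambda>s. - b s))"
    if b: "0 < d" "b \<in> face t l" "\<And>s. d \<le> cmod (f s) \<Longrightarrow> b s = 0" for d b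
  proof (cases "d \<le> 1/2")
    case True
    define w where "w = - \<Delta> (\<lambda>s. - b s)"
    have w: "norm w = 1"
      using face_uminus[OF b(2) l] norm_image face_subset by (auto simp: w_def)
    have "2 - 2 * d \<le> norm (y2 + ((1/4) *\<^sub>R y1 + (3/4) *\<^sub>R w))"
      using norm_face_sum_ge[OF a(1,2) l b(2,1) True b(3)] by (simp add: a w_def f_def)
    \<comment> \<open>Splitting off a quarter of \<open>m + w\<close> leaves nonnegative
      coefficients with sum 3/2. So 2 - 2d is at most 3/2 plus a quarter of the norm of
      \<open>m + w\<close>, which is where 8 d comes from.\<close>
    also have "y2 + ((1/4) *\<^sub>R y1 + (3/4) *\<^sub>R w)
        = (1/4) *\<^sub>R (m + w) + ((1 - q/4) *\<^sub>R y2 + (((1-p)/4) *\<^sub>R y1 + (1/2) *\<^sub>R w))"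
      by (simp add: m_def scaleR_add_right scaleR_diff_left diff_divide_distrib algebra_simps)
        (simp flip: scaleR_add_left)
    also have "norm \<dots> \<le> norm ((1/4) *\<^sub>R (m + w)) + (norm ((1 - q/4) *\<^sub>R y2) + (norm (((1-p)/4) *\<^sub>R y1) + norm ((1/2) *\<^sub>R w)))"
      by (intro norm_triangle_le add_mono order_refl)
    also have "\<dots> = (1/4) * norm (m + w) + ((1 - q/4) + ((1 - p)/4 + 1/2))"
      using pq n w by simp
    also have "(1 - q/4) + ((1 - p)/4 + 1/2) = 3/2"
      using pq(3) by (simp add: field_simps)
    finally show ?thesis
      by (simp add: w_def)
  next
    case False
    then show ?thesis
      using norm_ge_zero[of "m - \<Delta> (\<lambda>s. - b s)"] by linarith
  qed
  have "norm m = 1"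
  proof (rule antisym)
    show "norm m \<le> 1"
      unfolding m_def using pq n norm_triangle_ineq[of "p *\<^sub>R y1" "q *\<^sub>R y2"] by simp
    show "1 \<le> norm m"
    proof (rule field_le_epsilon)
      fix e :: real assume e: "0 < e"
      define b where "b s = of_real (max 0 (1 - \<bar>cmod (f s)\<bar> / (e/8))) * a1 s" for s
      have b: "b \<in> face t l"
        unfolding b_def by (rule face_bump) (use a l f e in auto)
      have "2 - 8 * (e/8) \<le> norm (m - \<Delta> (\<lambda>s. - b s))"
        by (rule key[OF _ b]) (use e in \<open>simp_all add: b_def\<close>)
      moreover have "norm (\<Delta> (\<lambda>s. - b s)) = 1"
        using face_uminus[OF b l] norm_image face_subset by auto
      ultimately show "1 \<le> norm m + e"
        using norm_triangle_ineq4[of m "\<Delta> (\<lambda>s. - b s)"] by simp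
    qed
  qed
  then obtain c where c: "c \<in> E" "\<And>s. cmod (c s) \<le> 1" "c \<in> unit_sphere" "\<Delta> c = m"
    using obtain_preimage[of m] by auto
  \<comment> \<open>The distances known are those from \<open>c\<close> to negatives of face
    elements, so the test is applied to \<open>-c\<close>.\<close>
  have "2 \<le> cmod ((- c t) - l)"
  proof (rule peak_bound[where c = "\<lambda>s. - c s" and u = a1 and f = f])
    fix d b assume b: "0 < d" "b \<in> face t l" "\<And>s. d \<le> cmod (f s) \<Longrightarrow> b s = 0"
    have "2 - 8 * d \<le> norm (m - \<Delta> (\<lambda>s. - b s))"
      using b by (rule key)
    also have "\<dots> = sup_norm L (\<lambda>s. c s - - b s)"
      using isometry[OF c(3), of "\<lambda>s. - b s"] face_uminus[OF b(2) l] face_subset c(4) by auto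
    also have "\<dots> = sup_norm L (\<lambda>s. - c s - b s)"
    proof -
      have "- c s - b s = - (c s - - b s)" for s
        by simp
      then show ?thesis
        by (simp only: sup_norm_def norm_minus_cancel)
    qed
    finally show "2 - 8 * d \<le> sup_norm L (\<lambda>s. - c s - b s)" .
  qed (use a c l f uminus_closed in auto)
  then have "- c t = - l"
    using c(2)[of t] l by (intro cmod_diff_eq_two_imp) auto
  then have "c \<in> face t l"
    using c(3) by (simp add: face_def)
  then show "p *\<^sub>R y1 + q *\<^sub>R y2 \<in> \<Delta> ` face t l"
    using imageI[of c "face t l" \<Delta>] c(4) by (simp add: m_def)
qed

lemma complex_sphere_face_image:
  assumes "face t l \<noteq> {}" "cmod l = 1"
  shows "complex_sphere_face scaleX (\<Delta> ` face t l)"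
  by unfold_locales
    (use assms convex_image_face norm_image face_subset in \<open>auto simp: norm_image subset_iff\<close>)

section \<open>Images of antipodal and rotated faces\<close>

lemma peak_bound_image:
  assumes d: "d \<in> unit_sphere" and l: "cmod l = 1" and ne: "face t l \<noteq> {}" and \<rho>: "1 < \<rho>"
    and far: "\<And>a. a \<in> face t l \<Longrightarrow> \<rho> \<le> norm (\<Delta> d - \<Delta> a)"
  shows "\<rho> \<le> cmod (d t - l)"
proof (rule peak_bound_simple)
  show "\<rho> \<le> sup_norm L (\<lambda>s. d s - a s)" if "a \<in> face t l" for a
    using far[OF that] isometry[OF d subsetD[OF face_subset that]] by simp
  show "cmod (d s) \<le> 1" for s
    using d cmod_le_sup_norm[of d s] by (auto simp: unit_sphere_def)
qed (use assms in \<open>auto simp: unit_sphere_def\<close>)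

text \<open>The midpoint of \<open>y\<close> and any \<Delta> a in the image lies in the image by
  convexity and has norm 1. So -y is at distance 2 from the whole image, and its preimage can only
  take the value -l at \<open>t\<close>.\<close>

lemma uminus_image_face_subset:
  assumes l: "cmod l = 1" and y: "y \<in> \<Delta> ` face t l"
  shows "- y \<in> \<Delta> ` face t (- l)"
proof -
  have ny: "norm y = 1"
    using y face_subset norm_image by auto
  then obtain d where d: "d \<in> E" "\<And>s. cmod (d s) \<le> 1" "d \<in> unit_sphere" "\<Delta> d = - y"
    using obtain_preimage[of "- y"] by auto
  have "2 \<le> cmod (d t - l)"
  proof (rule peak_bound_image)
    fix a assume a: "a \<in> face t l"
    have "(1/2) *\<^sub>R y + (1/2) *\<^sub>R \<Delta> a \<in> \<Delta> ` face t l"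
      using a y by (intro convexD convex_image_face l) auto
    then have "norm ((1/2) *\<^sub>R (y + \<Delta> a)) = 1"
      using norm_image subsetD[OF face_subset] by (auto simp: scaleR_add_right)
    moreover have "norm (\<Delta> d - \<Delta> a) = norm (y + \<Delta> a)"
      using norm_minus_cancel[of "y + \<Delta> a"] by (simp add: d)
    ultimately show "2 \<le> norm (\<Delta> d - \<Delta> a)"
      by simp
  qed (use d l y in auto)
  then have "d t = - l"
    using d l by (intro cmod_diff_eq_two_imp)
  then show ?thesis
    using d by (force simp: face_def)
qed

text \<open>The point \<i> y is at distance at least sqrt 2 from the images of both
  \<open>face t l\<close> and \<open>face t (- l)\<close>. In the closed unit disc only \<i> and
  -\<i> are that far from both 1 and -1.\<close>

lemma imaginary_unit_image_face_mem:
  assumes l: "cmod l = 1" and y: "y \<in> \<Delta> ` face t l"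
  shows "scaleX \<i> y \<in> \<Delta> ` face t (\<i> * l) \<or> scaleX \<i> y \<in> \<Delta> ` face t (- \<i> * l)"
proof -
  have ne: "face t l \<noteq> {}"
    using y by auto
  interpret C: complex_sphere_face scaleX "\<Delta> ` face t l"
    using ne l by (rule complex_sphere_face_image)
  have "norm (scaleX \<i> y) = 1"
    using y C.subset_sphere by (auto simp: norm_scaleC)
  then obtain d where d: "d \<in> E" "\<And>s. cmod (d s) \<le> 1" "d \<in> unit_sphere" "\<Delta> d = scaleX \<i> y"
    using obtain_preimage[of "scaleX \<i> y"] by auto
  have sqrt2: "cmod (\<i> - 1) = sqrt 2" "cmod (\<i> + 1) = sqrt 2"
    by (simp_all add: cmod_def)
  have 1: "sqrt 2 \<le> cmod (d t - l)"
  proof (rule peak_bound_image)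
    show "sqrt 2 \<le> norm (\<Delta> d - \<Delta> a)" if "a \<in> face t l" for a
      using C.norm_diff_rotated_face_ge[of y "\<Delta> a" \<i> 1] y that sqrt2 by (simp add: d)
  qed (use d l ne in auto)
  have 2: "sqrt 2 \<le> cmod (d t - (- l))"
  proof (rule peak_bound_image)
    fix a assume a: "a \<in> face t (- l)"
    then have "- \<Delta> a \<in> \<Delta> ` face t l"
      using uminus_image_face_subset[of "- l" "\<Delta> a" t] l by auto
    then show "sqrt 2 \<le> norm (\<Delta> d - \<Delta> a)"
      using C.norm_diff_rotated_face_ge[of y "- \<Delta> a" \<i> "-1"] y sqrt2 by (simp add: d)
  qed (use d l ne face_nonempty_trans in auto)
  have l0: "l \<noteq> 0"
    using l by auto
  define z where "z = d t / l"
  have "z - 1 = (d t - l) / l" "z + 1 = (d t + l) / l"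
    using l0 by (simp_all add: z_def diff_divide_distrib add_divide_distrib)
  then have "cmod (z - 1) = cmod (d t - l)" "cmod (z + 1) = cmod (d t + l)"
    using l by (simp_all add: norm_divide)
  then have "(sqrt 2)\<^sup>2 \<le> (cmod (z - 1))\<^sup>2" "(sqrt 2)\<^sup>2 \<le> (cmod (z + 1))\<^sup>2"
    using power_mono[OF 1, of 2] power_mono[OF 2, of 2] by simp_all
  moreover have "(cmod z)\<^sup>2 \<le> 1"
    using d(2)[of t] l by (simp add: z_def norm_divide power_le_one)
  ultimately have "1 + 2 * Re z \<le> (cmod z)\<^sup>2" "1 - 2 * Re z \<le> (cmod z)\<^sup>2" "(cmod z)\<^sup>2 \<le> 1"
    unfolding cmod_power2 by (simp_all add: power2_eq_square algebra_simps)
  then have "Re z = 0" "(cmod z)\<^sup>2 = 1"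
    by linarith+
  then have "Re z = 0 \<and> (Im z)\<^sup>2 = 1"
    by (simp add: cmod_power2)
  then have "z = \<i> \<or> z = - \<i>"
    by (auto simp: complex_eq_iff power2_eq_1_iff)
  then have "d t = \<i> * l \<or> d t = - \<i> * l"
    using l0 by (auto simp: z_def field_simps)
  then show ?thesis
    using d by (force simp: face_def)
qed

text \<open>The sign is uniform by convexity: the midpoint of two points with different signs is
  within 1 of both, but its rotation by \<i> lies in one of two faces at distance 2 from each
  other.\<close>

lemma imaginary_unit_image_face_subset:
  assumes l: "cmod l = 1" and ne: "face t l \<noteq> {}"
  shows "\<exists>j\<in>{\<i>, -\<i>}. \<forall>y\<in>\<Delta> ` face t l. scaleX \<i> y \<in> \<Delta> ` face t (j * l)"
proof (rule ccontr)
  assume "\<not> ?thesis"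
  then obtain y1 y2 where "y1 \<in> \<Delta> ` face t l" "scaleX \<i> y1 \<notin> \<Delta> ` face t (\<i> * l)"
      "y2 \<in> \<Delta> ` face t l" "scaleX \<i> y2 \<notin> \<Delta> ` face t (- \<i> * l)"
    by auto
  then have y: "y1 \<in> \<Delta> ` face t l" "scaleX \<i> y1 \<in> \<Delta> ` face t (- \<i> * l)"
      "y2 \<in> \<Delta> ` face t l" "scaleX \<i> y2 \<in> \<Delta> ` face t (\<i> * l)"
    using imaginary_unit_image_face_mem[OF l] by blast+
  have n: "norm y1 = 1" "norm y2 = 1"
    using y face_subset norm_image by auto
  define m where "m = (1/2) *\<^sub>R y1 + (1/2) *\<^sub>R y2"
  have "m \<in> \<Delta> ` face t l"
    unfolding m_def using y by (intro convexD convex_image_face l) auto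
  then obtain b where b: "b \<in> unit_sphere" "scaleX \<i> m = \<Delta> b" "b t = \<i> * l \<or> b t = - \<i> * l"
    using imaginary_unit_image_face_mem[OF l, of m t] by (auto simp: face_def)
  have close: "norm (m - y1) \<le> 1" "norm (m - y2) \<le> 1"
  proof -
    have "2 *\<^sub>R (m - y1) = y2 - y1" "2 *\<^sub>R (m - y2) = y1 - y2"
      by (simp_all add: m_def algebra_simps scaleR_2)
    then have "2 * norm (m - y1) = norm (y2 - y1)" "2 * norm (m - y2) = norm (y1 - y2)"
      by (metis norm_scaleR abs_numeral)+
    then show "norm (m - y1) \<le> 1" "norm (m - y2) \<le> 1"
      using norm_triangle_ineq4[of y1 y2] norm_triangle_ineq4[of y2 y1] n by simp_all
  qed
  have far: "cmod (b t - c t) \<le> norm (m - v)"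
    if "c \<in> unit_sphere" "\<Delta> c = scaleX \<i> v" for c v
  proof -
    have "cmod (b t - c t) \<le> sup_norm L (\<lambda>s. b s - c s)"
      using b(1) that(1)
      by (intro cmod_le_sup_norm[where a = "\<lambda>s. b s - c s"] diff_closed) (auto simp: unit_sphere_def)
    also have "\<dots> = norm (scaleX \<i> (m - v))"
      using isometry[OF b(1) that(1)] b(2) that(2) by (simp add: scale_right_diff_distrib)
    finally show ?thesis
      by (simp add: norm_scaleC)
  qed
  obtain c1 c2 where c: "c1 \<in> unit_sphere" "\<Delta> c1 = scaleX \<i> y1" "c1 t = - \<i> * l"
      "c2 \<in> unit_sphere" "\<Delta> c2 = scaleX \<i> y2" "c2 t = \<i> * l"
    using y(2,4) by (auto simp: face_def)
  have "cmod (b t - - \<i> * l) \<le> 1" "cmod (b t - \<i> * l) \<le> 1"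
    using far[OF c(1,2)] far[OF c(4,5)] close by (auto simp: c)
  then show False
    using b(3) l by (auto simp: norm_mult norm_minus_commute simp flip: mult_2)
qed

text \<open>Applying the inclusion twice gives multiplication by -1, so the second step ends in the
  image of \<open>face t (- l)\<close>. Surjectivity follows from y = \<i> (-\<i> y).\<close>

lemma imaginary_unit_image_face_eq:
  assumes l: "cmod l = 1" and ne: "face t l \<noteq> {}"
  shows "\<exists>j\<in>{\<i>, -\<i>}. scaleX \<i> ` \<Delta> ` face t l = \<Delta> ` face t (j * l)"
proof -
  obtain j where j: "j \<in> {\<i>, -\<i>}" "\<And>y. y \<in> \<Delta> ` face t l \<Longrightarrow> scaleX \<i> y \<in> \<Delta> ` face t (j * l)"
    using imaginary_unit_image_face_subset[OF assms] by blast
  have jl: "cmod (j * l) = 1"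
    using j(1) l by (auto simp: norm_mult)
  have nej: "face t (j * l) \<noteq> {}"
    using face_nonempty_trans[OF ne l jl] .
  obtain k where k: "k \<in> {\<i>, -\<i>}" "\<And>y. y \<in> \<Delta> ` face t (j * l) \<Longrightarrow> scaleX \<i> y \<in> \<Delta> ` face t (k * (j * l))"
    using imaginary_unit_image_face_subset[OF jl nej] by blast
  obtain a where a: "a \<in> face t l"
    using ne by auto
  have "scaleX \<i> (scaleX \<i> (\<Delta> a)) = - \<Delta> a"
    by simp
  then have "- \<Delta> a \<in> \<Delta> ` face t (k * (j * l))"
    using k(2)[OF j(2)[OF imageI[OF a]]] by simp
  moreover obtain c where c: "c \<in> face t (- l)" "- \<Delta> a = \<Delta> c"
    using uminus_image_face_subset[OF l imageI[OF a]] by auto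
  ultimately have kjl: "k * (j * l) = - l"
    using image_face_eqD[of c t "k * (j * l)"] faceD(2)[OF c(1)] face_subset[of t "- l"] by auto
  have "y \<in> scaleX \<i> ` \<Delta> ` face t l" if "y \<in> \<Delta> ` face t (j * l)" for y
  proof -
    have "- scaleX \<i> y \<in> \<Delta> ` face t (- (- l))"
      using k(2)[OF that] l unfolding kjl by (intro uminus_image_face_subset) auto
    moreover have "y = scaleX \<i> (- scaleX \<i> y)"
      by simp
    ultimately show ?thesis
      by (metis add.inverse_inverse imageI)
  qed
  then have "\<Delta> ` face t (j * l) \<subseteq> scaleX \<i> ` \<Delta> ` face t l"
    by (rule subsetI)
  moreover have "scaleX \<i> ` \<Delta> ` face t l \<subseteq> \<Delta> ` face t (j * l)"
    by (rule image_subsetI) (rule j(2))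
  ultimately show ?thesis
    by (intro bexI[OF _ j(1)] equalityI)
qed

text \<open>The images of the four faces at 1, -1, \<i>, -\<i> times \<open>l\<close> are known
  rotations of the image of \<open>face t l\<close>. Distances to them locate the preimage of the
  rotated \<open>y\<close> by \<open>eq_if_cmod_diff_ge\<close>.\<close>

lemma rotated_image_face_subset:
  assumes l: "cmod l = 1" and ne: "face t l \<noteq> {}" and \<mu>: "cmod \<mu> = 1"
  shows "\<exists>\<kappa>\<in>{\<mu>, cnj \<mu>}. \<forall>y\<in>\<Delta> ` face t l. scaleX \<kappa> y \<in> \<Delta> ` face t (\<mu> * l)"
proof -
  interpret C: complex_sphere_face scaleX "\<Delta> ` face t l"
    using ne l by (rule complex_sphere_face_image)
  obtain j where j: "j \<in> {\<i>, -\<i>}" "scaleX \<i> ` \<Delta> ` face t l = \<Delta> ` face t (j * l)"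
    using imaginary_unit_image_face_eq[OF l ne] by blast
  \<comment> \<open>\<sigma> records whether multiplication by \<i> on the image corresponds to \<i>
    or to -\<i> on the values at \<open>t\<close>.\<close>
  define \<sigma> where "\<sigma> = (if j = \<i> then (\<lambda>z. z) else cnj)"
  have \<sigma>: "cmod (\<sigma> z - \<sigma> w) = cmod (z - w)" "cmod (\<sigma> z) = cmod z" for z w
    by (auto simp: \<sigma>_def simp flip: complex_cnj_diff)
  have axis: "\<exists>u\<in>\<Delta> ` face t l. \<Delta> a = scaleX (\<sigma> \<epsilon>) u"
    if a: "a \<in> face t (\<epsilon> * l)" and \<epsilon>: "\<epsilon> \<in> {1, -1, \<i>, -\<i>}" for a \<epsilon>
  proof -
    have pos: "\<exists>u\<in>\<Delta> ` face t l. \<Delta> a = scaleX \<i> u" if "a \<in> face t (j * l)" for a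
      using that j(2) by blast
    have neg: "\<exists>u\<in>\<Delta> ` face t l. \<Delta> a = - scaleX \<i> u" if "a \<in> face t (- (j * l))" for a
    proof -
      have "- \<Delta> a \<in> \<Delta> ` face t (j * l)"
        using uminus_image_face_subset[of "- (j * l)" "\<Delta> a" t] that l j(1) by (auto simp: norm_mult)
      then have "- \<Delta> a \<in> scaleX \<i> ` \<Delta> ` face t l"
        using j(2) by simp
      then show ?thesis
        by (metis (no_types, lifting) add.inverse_inverse imageE)
    qed
    have minus: "\<exists>u\<in>\<Delta> ` face t l. \<Delta> a = - u" if "a \<in> face t (- l)" for a
    proof -
      have "- \<Delta> a \<in> \<Delta> ` face t l"
        using uminus_image_face_subset[of "- l" "\<Delta> a" t] that l by simp
      then show ?thesis
        by (intro bexI[of _ "- \<Delta> a"]) simp_all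
    qed
    show ?thesis
      using pos[of a] neg[of a] minus[of a] a \<epsilon> j(1) by (auto simp: \<sigma>_def)
  qed
  have "scaleX (\<sigma> \<mu>) y \<in> \<Delta> ` face t (\<mu> * l)" if y: "y \<in> \<Delta> ` face t l" for y
  proof -
    have "norm (scaleX (\<sigma> \<mu>) y) = 1"
      using y C.subset_sphere \<mu> \<sigma>(2)[of \<mu>] by (auto simp: norm_scaleC)
    then obtain d where d: "d \<in> E" "\<And>s. cmod (d s) \<le> 1" "d \<in> unit_sphere" "\<Delta> d = scaleX (\<sigma> \<mu>) y"
      using obtain_preimage[of "scaleX (\<sigma> \<mu>) y"] by auto
    have l0: "l \<noteq> 0"
      using l by auto
    have "d t / l = \<mu>"
    proof (rule eq_if_cmod_diff_ge[OF _ \<mu>])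
      show "cmod (d t / l) \<le> 1"
        using d(2)[of t] l by (simp add: norm_divide)
      fix \<epsilon> assume \<epsilon>: "\<epsilon> \<in> {1, -1, \<i>, -\<i>}" "1 < cmod (\<mu> - \<epsilon>)"
      have \<epsilon>l: "cmod (\<epsilon> * l) = 1"
        using \<epsilon>(1) l by (auto simp: norm_mult)
      have "cmod (\<mu> - \<epsilon>) \<le> cmod (d t - \<epsilon> * l)"
      proof (rule peak_bound_image[OF d(3) \<epsilon>l])
        fix a assume "a \<in> face t (\<epsilon> * l)"
        then obtain u where u: "u \<in> \<Delta> ` face t l" "\<Delta> a = scaleX (\<sigma> \<epsilon>) u"
          using axis \<epsilon>(1) by blast
        show "cmod (\<mu> - \<epsilon>) \<le> norm (\<Delta> d - \<Delta> a)"
          using C.norm_diff_rotated_face_ge[OF y u(1), of "\<sigma> \<mu>" "\<sigma> \<epsilon>"] u(2) by (simp add: d \<sigma>)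
      qed (use \<epsilon> face_nonempty_trans[OF ne l \<epsilon>l] in auto)
      also have "d t - \<epsilon> * l = (d t / l - \<epsilon>) * l"
        using l0 by (simp add: left_diff_distrib)
      finally show "cmod (\<mu> - \<epsilon>) \<le> cmod (d t / l - \<epsilon>)"
        using l by (simp add: norm_mult)
    qed
    then have "d \<in> face t (\<mu> * l)"
      using d(3) l0 by (auto simp: face_def)
    then show ?thesis
      using d(4) by (metis imageI)
  qed
  moreover have "\<sigma> \<mu> \<in> {\<mu>, cnj \<mu>}"
    by (simp add: \<sigma>_def)
  ultimately show ?thesis by blast
qed

section \<open>Busemann functions evaluated on the isometry\<close>

text \<open>With a t = r \<omega>, nearest points in the faces at \<omega> and -\<omega> provide the
  two discs of \<open>busemann_tangent_discs\<close>, which settles the face at \<omega>. A rotation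
  by \<kappa> passes to \<open>l\<close>; as \<kappa> is \<mu> or its conjugate, the real part is
  the same in both cases.\<close>

lemma busemann_image:
  assumes l: "cmod l = 1" and ne: "face t l \<noteq> {}" and a: "a \<in> unit_sphere"
  shows "busemann (\<Delta> ` face t l) (\<Delta> a) = Re (cnj l * a t)"
proof -
  have aE: "a \<in> E" "cmod (a s) \<le> 1" for s
    using a cmod_le_sup_norm[of a s] by (auto simp: unit_sphere_def)
  \<comment> \<open>At a zero of \<open>a\<close> any unimodular \<omega> would do;
    \<open>sgn\<close> would give 0 there, hence the value 1.\<close>
  obtain r \<omega> where r: "0 \<le> r" "a t = of_real r * \<omega>" and \<omega>: "cmod \<omega> = 1"
  proof
    show "a t = of_real (cmod (a t)) * (if a t = 0 then 1 else sgn (a t))"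
      by (simp add: sgn_eq)
  qed (auto simp: norm_sgn)
  have ne\<omega>: "face t \<omega> \<noteq> {}"
    using face_nonempty_trans[OF ne l \<omega>] .
  interpret C: complex_sphere_face scaleX "\<Delta> ` face t l"
    using ne l by (rule complex_sphere_face_image)
  interpret D: complex_sphere_face scaleX "\<Delta> ` face t \<omega>"
    using ne\<omega> \<omega> by (rule complex_sphere_face_image)
  have near: "norm (\<Delta> a - \<Delta> b) \<le> q" if "b \<in> face t l'" "\<And>s. cmod (a s - b s) \<le> q" for b l' q
  proof -
    have "norm (\<Delta> a - \<Delta> b) = sup_norm L (\<lambda>s. a s - b s)"
      using isometry[OF a, of b] that(1) face_subset by auto
    also have "\<dots> \<le> q"
      using that(2) order_trans[OF norm_ge_zero that(2)] by (intro sup_norm_le) auto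
    finally show ?thesis .
  qed
  obtain b where b: "b \<in> face t \<omega>" "norm (\<Delta> a - \<Delta> b) \<le> 1 - r"
  proof (cases "r = 0")
    case True
    then obtain b where "b \<in> face t \<omega>" "\<forall>s. cmod (a s - b s) \<le> 1"
      using face_nearest_zero[OF aE _ \<omega> ne\<omega>] r by auto
    then show thesis
      using that near[of b \<omega> 1] True by auto
  next
    case False
    then obtain b where "b \<in> face t \<omega>" "\<forall>s. cmod (a s - b s) \<le> 1 - r"
      using face_nearest[OF aE r(2) _ \<omega>] r(1) by auto
    then show thesis
      using that near[of b \<omega> "1 - r"] by auto
  qed
  have \<omega>': "cmod (- \<omega>) = 1"
    using \<omega> by simp
  obtain b' where b': "b' \<in> face t (- \<omega>)" "norm (\<Delta> a - \<Delta> b') \<le> 1 + r"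
  proof (cases "r = 0")
    case True
    then obtain b where "b \<in> face t (- \<omega>)" "\<forall>s. cmod (a s - b s) \<le> 1"
      using face_nearest_zero[OF aE _ \<omega>' face_nonempty_trans[OF ne\<omega> \<omega> \<omega>']] r by auto
    then show thesis
      using that near[of b "- \<omega>" 1] True by auto
  next
    case False
    then obtain b where "b \<in> face t (- \<omega>)" "\<forall>s. cmod (a s - b s) \<le> 1 + r"
      using face_antipodal_nearest[OF aE r(2) _ \<omega>] r(1) by auto
    then show thesis
      using that near[of b "- \<omega>" "1 + r"] by auto
  qed
  have "- \<Delta> b' \<in> \<Delta> ` face t \<omega>"
    using uminus_image_face_subset[OF \<omega>' imageI[OF b'(1)]] by simp
  then have D: "busemann (\<Delta> ` face t \<omega>) (scaleX z (\<Delta> a)) \<le> r * Re z" for z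
    using D.busemann_tangent_discs[OF imageI[OF b(1)] b(2), of "- \<Delta> b'" z] b'(2) by simp
  define \<mu> where "\<mu> = l / \<omega>"
  have \<mu>: "cmod \<mu> = 1" "\<mu> * \<omega> = l"
    using l \<omega> by (auto simp: \<mu>_def norm_divide)
  obtain \<kappa> where \<kappa>: "\<kappa> \<in> {\<mu>, cnj \<mu>}" "\<And>y. y \<in> \<Delta> ` face t \<omega> \<Longrightarrow> scaleX \<kappa> y \<in> \<Delta> ` face t l"
    using rotated_image_face_subset[OF \<omega> ne\<omega> \<mu>(1)] unfolding \<mu>(2) by blast
  have \<kappa>1: "cmod \<kappa> = 1" "Re \<kappa> = Re \<mu>"
    using \<kappa>(1) \<mu>(1) by auto
  have \<kappa>\<kappa>: "\<kappa> * cnj \<kappa> = 1"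
    using \<kappa>1(1) by (simp add: complex_norm_square[symmetric])
  \<comment> \<open>Upper bounds suffice: z = -1 gives the reverse inequality by
    sublinearity.\<close>
  have le: "busemann (\<Delta> ` face t l) (scaleX z (\<Delta> a)) \<le> r * Re (cnj \<kappa> * z)" for z
  proof -
    have "scaleX z (\<Delta> a) = scaleX (\<kappa> * cnj \<kappa> * z) (\<Delta> a)"
      by (simp only: \<kappa>\<kappa> mult_1)
    also have "\<dots> = scaleX \<kappa> (scaleX (cnj \<kappa> * z) (\<Delta> a))"
      by (simp only: scale_scale mult.assoc)
    also have "busemann (\<Delta> ` face t l) \<dots> \<le> busemann (\<Delta> ` face t \<omega>) (scaleX (cnj \<kappa> * z) (\<Delta> a))"
      by (rule busemann_rotate_le[OF D.complex_sphere_face_axioms C.complex_sphere_face_axioms \<kappa>1(1) \<kappa>(2)])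
    also have "\<dots> \<le> r * Re (cnj \<kappa> * z)"
      by (rule D)
    finally show ?thesis .
  qed
  have "busemann (\<Delta> ` face t l) (\<Delta> a) = r * Re \<mu>"
  proof (rule antisym)
    show "busemann (\<Delta> ` face t l) (\<Delta> a) \<le> r * Re \<mu>"
      using le[of 1] \<kappa>1(2) by simp
    have "busemann (\<Delta> ` face t l) (- \<Delta> a) \<le> - (r * Re \<mu>)"
      using le[of "-1"] \<kappa>1(2) by simp
    then show "r * Re \<mu> \<le> busemann (\<Delta> ` face t l) (\<Delta> a)"
      using C.busemann_add_le[of "\<Delta> a" "- \<Delta> a"] C.busemann_zero by simp
  qed
  also have "\<dots> = Re (cnj l * a t)"
  proof -
    have "\<omega> * cnj \<omega> = 1"
      using \<omega> by (simp add: complex_norm_square[symmetric])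
    then have "cnj l * \<omega> = cnj \<mu>"
      by (metis \<mu>(2) complex_cnj_mult mult.assoc mult.commute mult_1)
    then have "cnj l * a t = of_real r * cnj \<mu>"
      by (simp add: r(2) mult.left_commute)
    then show ?thesis by simp
  qed
  finally show ?thesis .
qed

section \<open>The positively homogeneous extension\<close>

text \<open>At 0 the quotient \<open>1 / 0\<close> is 0 and \<Delta> is evaluated off the sphere,
  but the leading scalar 0 makes the value 0.\<close>

definition extension :: "('a \<Rightarrow> complex) \<Rightarrow> 'b"
  where "extension a = sup_norm L a *\<^sub>R \<Delta> (\<lambda>t. of_real (1 / sup_norm L a) * a t)"

lemma normalize_mem_sphere:
  assumes a: "a \<in> E" "sup_norm L a \<noteq> 0"
  shows "(\<lambda>t. of_real (1 / sup_norm L a) * a t) \<in> unit_sphere"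
proof -
  have "sup_norm L (\<lambda>t. of_real (1 / sup_norm L a) * a t) = 1"
    unfolding sup_norm_mult[OF a(1)] norm_of_real using a(2) sup_norm_nonneg[OF a(1)] by simp
  then show ?thesis
    using mult_closed[OF a(1)] unfolding unit_sphere_def by blast
qed

lemma norm_extension: "a \<in> E \<Longrightarrow> norm (extension a) = sup_norm L a"
  using norm_image[OF normalize_mem_sphere[of a]] sup_norm_nonneg[of a]
  by (cases "sup_norm L a = 0") (auto simp: extension_def)

lemma extension_eq: "a \<in> unit_sphere \<Longrightarrow> extension a = \<Delta> a"
  by (simp add: extension_def unit_sphere_def)

lemma extension_scaleR_nonneg:
  assumes a: "a \<in> E" and r: "0 \<le> r"
  shows "extension (\<lambda>t. of_real r * a t) = r *\<^sub>R extension a"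
proof (cases "r = 0 \<or> sup_norm L a = 0")
  case True
  then show ?thesis
    using sup_norm_mult[OF a, of "of_real r"] by (auto simp: extension_def)
next
  case False
  then show ?thesis
    using sup_norm_mult[OF a, of "of_real r"] r by (simp add: extension_def)
qed

lemma surj_extension: "extension ` E = UNIV"
proof -
  have "x \<in> extension ` E" for x
  proof (cases "x = 0")
    case True
    then have "x = extension (\<lambda>t. 0)"
      using norm_extension[OF zero_closed] sup_norm_mult[OF zero_closed, of 0] by simp
    then show ?thesis
      using zero_closed by blast
  next
    case False
    then obtain a where a: "a \<in> E" "a \<in> unit_sphere" "\<Delta> a = (1 / norm x) *\<^sub>R x"
      using obtain_preimage[of "(1 / norm x) *\<^sub>R x"] by auto
    then have "extension (\<lambda>t. of_real (norm x) * a t) = x"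
      using False by (simp add: extension_scaleR_nonneg extension_eq)
    then show ?thesis
      using mult_closed[OF a(1)] by (metis imageI)
  qed
  then show ?thesis by auto
qed

text \<open>After normalization, \<open>face_nearest\<close> raises the modulus at \<open>t\<close>
  to 1, and a rotation corrects the phase.\<close>

lemma face_nonempty:
  assumes a: "a \<in> E" and at: "a t \<noteq> 0" and l: "cmod l = 1"
  shows "face t l \<noteq> {}"
proof -
  have n: "0 < sup_norm L a"
    using cmod_le_sup_norm[OF a, of t] at by (smt (verit) zero_less_norm_iff)
  let ?b = "\<lambda>s. of_real (1 / sup_norm L a) * a s"
  have "?b \<in> E"
    by (rule mult_closed[OF a])
  moreover have "cmod (?b s) \<le> 1" for s
    unfolding norm_mult norm_of_real using cmod_le_sup_norm[OF a, of s] n by simp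
  moreover have "?b t = of_real (cmod (?b t)) * sgn (?b t)"
    by (simp only: sgn_eq) simp
  moreover have "?b t \<noteq> 0"
    using at n by simp
  ultimately have "face t (sgn (?b t)) \<noteq> {}"
    using face_nearest[of ?b t "cmod (?b t)" "sgn (?b t)"]
    by (metis empty_iff norm_sgn zero_less_norm_iff)
  then show ?thesis
    by (rule face_nonempty_trans) (metis \<open>?b t \<noteq> 0\<close> norm_sgn, rule l)
qed

lemma busemann_extension:
  assumes l: "cmod l = 1" and ne: "face t l \<noteq> {}" and a: "a \<in> E"
  shows "busemann (\<Delta> ` face t l) (extension a) = Re (cnj l * a t)"
proof -
  interpret C: complex_sphere_face scaleX "\<Delta> ` face t l"
    using ne l by (rule complex_sphere_face_image)
  show ?thesis
  proof (cases "sup_norm L a = 0")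
    case True
    then show ?thesis
      using sup_norm_eq_0[OF a] by (simp add: extension_def C.busemann_zero)
  next
    case False
    have "busemann (\<Delta> ` face t l) (extension a)
        = sup_norm L a * Re (cnj l * (of_real (1 / sup_norm L a) * a t))"
      unfolding extension_def C.busemann_scaleR[OF sup_norm_nonneg[OF a]]
      by (subst busemann_image[OF l ne normalize_mem_sphere[OF a False]]) simp
    also have "cnj l * (of_real (1 / sup_norm L a) * a t) = of_real (1 / sup_norm L a) * (cnj l * a t)"
      by (simp only: mult.left_commute)
    also have "sup_norm L a * Re \<dots> = Re (cnj l * a t)"
      using False by (simp del: times_complex.sel complex_cnj)
    finally show ?thesis .
  qed
qed

text \<open>Surjectivity supplies \<open>c\<close> mapped to the right-hand side, so it remains to
  identify \<open>c\<close>. Replacing \<open>l\<close> by \<open>-l\<close> reverses the inequality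
  from sublinearity; hence 1, -1, \<i>, -\<i> give equal real and imaginary parts.\<close>

lemma extension_add:
  assumes a: "a \<in> E" and b: "b \<in> E"
  shows "extension (\<lambda>t. a t + b t) = extension a + extension b"
proof -
  obtain c where c: "c \<in> E" "extension c = extension a + extension b"
    using surj_extension by (metis UNIV_I imageE)
  have "c t = a t + b t" for t
  proof (cases "face t 1 = {}")
    case True
    \<comment> \<open>If the face is empty, all of \<open>E\<close> vanishes at \<open>t\<close>,
      and there is nothing to compare.\<close>
    then have "f t = 0" if "f \<in> E" for f
      using face_nonempty[OF that, of t 1] by auto
    from this[OF a] this[OF b] this[OF c(1)] show ?thesis
      by simp
  next
    case False
    have *: "Re (cnj l * c t) \<le> Re (cnj l * a t) + Re (cnj l * b t)" if l: "cmod l = 1" for l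
    proof -
      have ne: "face t l \<noteq> {}"
        using face_nonempty_trans[OF False _ l] by simp
      interpret C: complex_sphere_face scaleX "\<Delta> ` face t l"
        using ne l by (rule complex_sphere_face_image)
      show ?thesis
        using C.busemann_add_le[of "extension a" "extension b"]
        unfolding c(2)[symmetric] busemann_extension[OF l ne a] busemann_extension[OF l ne b]
          busemann_extension[OF l ne c(1)] .
    qed
    show ?thesis
      using *[of 1] *[of "-1"] *[of \<i>] *[of "-\<i>"] by (simp add: complex_eq_iff)
  qed
  then have "c = (\<lambda>t. a t + b t)"
    by auto
  then show ?thesis
    using c(2) by simp
qed

lemma extension_diff:
  assumes a: "a \<in> E" and b: "b \<in> E"
  shows "extension (\<lambda>t. a t - b t) = extension a - extension b"
  using extension_add[OF diff_closed[OF a b] b] by (simp add: algebra_simps)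

lemma extension_scaleR:
  assumes a: "a \<in> E"
  shows "extension (\<lambda>t. r *\<^sub>R a t) = r *\<^sub>R extension a"
proof (cases "0 \<le> r")
  case True
  then show ?thesis
    using extension_scaleR_nonneg[OF a] by (simp add: scaleR_conv_of_real)
next
  case False
  have "extension (\<lambda>t. 0) = 0"
    using extension_diff[OF a a] by simp
  then have "extension (\<lambda>t. 0 - of_real (- r) * a t) = - ((- r) *\<^sub>R extension a)"
    using extension_diff[OF zero_closed mult_closed[OF a, of "of_real (- r)"]]
      extension_scaleR_nonneg[OF a, of "- r"] False by simp
  then show ?thesis
    by (simp add: scaleR_conv_of_real)
qed

lemma real_linear_extension: "real_linear_on E extension"
  by (simp add: real_linear_on_def extension_add extension_scaleR)

text \<open>By additivity, norm preservation applied to differences gives distance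
  preservation.\<close>

lemma sup_isometry_extension: "sup_isometry_on L E extension"
  by (simp add: sup_isometry_on_def dist_norm norm_extension diff_closed flip: extension_diff)

end

subsection \<open>Circle-equivariant functions\<close>

lemma C0_bounded:
  assumes "a \<in> C0 L"
  shows "bdd_above ((\<lambda>t. cmod (a t)) ` L)"
proof -
  obtain K where K: "compact K" "K \<subseteq> L" "\<forall>t\<in>L - K. cmod (a t) < 1"
    using assms unfolding C0_def by (auto dest!: spec[of _ 1])
  have "compact ((\<lambda>t. cmod (a t)) ` K)"
    using assms K by (intro compact_continuous_image continuous_on_norm)
      (auto simp: C0_def intro: continuous_on_subset)
  then obtain B where B: "\<forall>t\<in>K. cmod (a t) \<le> B"
    using compact_imp_bounded bounded_imp_bdd_above by (fastforce simp: bdd_above_def)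
  have "cmod (a t) \<le> max B 1" if "t \<in> L" for t
    using B K(3) that by (cases "t \<in> K") (force simp: le_max_iff_disj)+
  then show ?thesis
    by (intro bdd_aboveI2)
qed

lemma C0_mult_bounded:
  assumes a: "a \<in> C0 L" and h: "continuous_on L h" and B: "\<And>t. t \<in> L \<Longrightarrow> cmod (h t) \<le> B"
  shows "(\<lambda>t. h t * a t) \<in> C0 L"
  unfolding C0_def
proof (intro CollectI conjI allI impI)
  show "continuous_on L (\<lambda>t. h t * a t)"
    using a h by (auto simp: C0_def intro: continuous_on_mult)
  show "h t * a t = 0" if "t \<notin> L" for t
    using a that by (simp add: C0_def)
  fix e :: real assume e: "0 < e"
  \<comment> \<open>\<open>B\<close> may be 0 or, for empty \<open>L\<close>, negative; the maximum
    with 1 makes \<open>e / M\<close> positive.\<close>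
  define M where "M = max B 1"
  have M: "0 < M" "\<And>t. t \<in> L \<Longrightarrow> cmod (h t) \<le> M"
    using B by (auto simp: M_def le_max_iff_disj)
  then have "0 < e / M"
    using e by simp
  then obtain K where K: "compact K" "K \<subseteq> L" "\<forall>t\<in>L - K. cmod (a t) < e / M"
    using a unfolding C0_def by blast
  have "cmod (h t * a t) < e" if t: "t \<in> L - K" for t
  proof -
    have "cmod (h t * a t) \<le> M * cmod (a t)"
      using M(2) t by (simp add: norm_mult mult_right_mono)
    also have "\<dots> < M * (e / M)"
      using K(3) t M(1) by (intro mult_strict_left_mono) auto
    finally show ?thesis
      using M(1) by simp
  qed
  then show "\<exists>K. compact K \<and> K \<subseteq> L \<and> (\<forall>t\<in>L - K. cmod (h t * a t) < e)"
    using K by blast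
qed

lemma C0_add:
  assumes a: "a \<in> C0 L" and b: "b \<in> C0 L"
  shows "(\<lambda>t. a t + b t) \<in> C0 L"
  unfolding C0_def
proof (intro CollectI conjI allI impI)
  show "continuous_on L (\<lambda>t. a t + b t)"
    using a b by (auto simp: C0_def intro: continuous_on_add)
  show "a t + b t = 0" if "t \<notin> L" for t
    using a b that by (simp add: C0_def)
  fix e :: real assume "0 < e"
  then have e: "0 < e / 2"
    by simp
  obtain K where K: "compact K" "K \<subseteq> L" "\<forall>t\<in>L - K. cmod (a t) < e / 2"
    using a e unfolding C0_def by blast
  obtain K' where K': "compact K'" "K' \<subseteq> L" "\<forall>t\<in>L - K'. cmod (b t) < e / 2"
    using b e unfolding C0_def by blast
  have "cmod (a t + b t) < e" if "t \<in> L - (K \<union> K')" for t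
  proof -
    have "cmod (a t) < e / 2" "cmod (b t) < e / 2"
      using K(3) K'(3) that by auto
    then show ?thesis
      using norm_triangle_ineq[of "a t" "b t"] by linarith
  qed
  then show "\<exists>K. compact K \<and> K \<subseteq> L \<and> (\<forall>t\<in>L - K. cmod (a t + b t) < e)"
    using K K' by (intro exI[of _ "K \<union> K'"]) (auto intro: compact_Un)
qed

text \<open>The modulus of an equivariant function is constant on circle orbits, so multiplying by a
  bounded continuous function of it preserves equivariance as well as decay at infinity.\<close>

lemma modulus_module_C0T: "modulus_module L (C0T scaleC L)"
proof
  fix a b f :: "'a \<Rightarrow> complex" and c t and k :: "real \<Rightarrow> real"
  show "(\<lambda>t. 0) \<in> C0T scaleC L"
    by (auto simp: C0T_def C0_def intro: exI[of _ "{}"])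
  assume a: "a \<in> C0T scaleC L"
  then have a0: "a \<in> C0 L" and aT: "\<And>c t. \<lbrakk>cmod c = 1; t \<in> L\<rbrakk> \<Longrightarrow> a (scaleC c t) = c * a t"
    by (auto simp: C0T_def)
  show "t \<notin> L \<Longrightarrow> a t = 0"
    using a0 by (simp add: C0_def)
  show "bdd_above ((\<lambda>t. cmod (a t)) ` L)"
    using a0 by (rule C0_bounded)
  show "(\<lambda>t. c * a t) \<in> C0T scaleC L"
    using C0_mult_bounded[OF a0, of "\<lambda>_. c" "cmod c"] aT by (simp add: C0T_def)
  show "(\<lambda>t. a t + b t) \<in> C0T scaleC L" if "b \<in> C0T scaleC L"
    using C0_add[OF a0, of b] aT that by (simp add: C0T_def distrib_left)
  assume f: "f \<in> C0T scaleC L" and k: "continuous_on UNIV k" "bounded (range k)"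
  then obtain B where B: "\<And>x. \<bar>k x\<bar> \<le> B"
    by (auto simp: bounded_iff)
  have "continuous_on L (\<lambda>t. k (cmod (f t)))"
    using f by (intro continuous_on_compose2[OF k(1)] continuous_on_norm) (auto simp: C0T_def C0_def)
  then have "(\<lambda>t. of_real (k (cmod (f t))) * a t) \<in> C0 L"
    by (intro C0_mult_bounded[OF a0, where B = B] continuous_on_of_real) (auto simp: B)
  moreover have "cmod (f (scaleC c t)) = cmod (f t)" if "cmod c = 1" "t \<in> L" for c t
    using f that by (simp add: C0T_def norm_mult)
  ultimately show "(\<lambda>t. of_real (k (cmod (f t))) * a t) \<in> C0T scaleC L"
    using aT by (simp add: C0T_def)
qed

theorem theorem3p1:
  fixes scaleL :: "complex \<Rightarrow> 'a::{real_vector, topological_ab_group_add, t2_space} \<Rightarrow> 'a"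
    and L :: "'a set"
    and scaleX :: "complex \<Rightarrow> 'b::banach \<Rightarrow> 'b"
    and \<Delta> :: "('a \<Rightarrow> complex) \<Rightarrow> 'b"
  assumes "principal_circle_bundle scaleL L"
    and "complex_banach_space scaleX"
    and "sup_isometry_on L (sphere_C0T scaleL L) \<Delta>"
    and "\<Delta> ` sphere_C0T scaleL L = sphere 0 1"
  shows "\<exists>T :: ('a \<Rightarrow> complex) \<Rightarrow> 'b.
    real_linear_on (C0T scaleL L) T \<and>
    sup_isometry_on L (C0T scaleL L) T \<and>
    T ` C0T scaleL L = UNIV \<and>
    (\<forall>a\<in>sphere_C0T scaleL L. T a = \<Delta> a)"
proof -
  interpret E: modulus_module L "C0T scaleL L"
    by (rule modulus_module_C0T)
  interpret X: complex_banach_space scaleX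
    by (rule assms)
  have sphere: "E.unit_sphere = sphere_C0T scaleL L"
    by (simp add: E.unit_sphere_def sphere_C0T_def)
  interpret sphere_isometry L "C0T scaleL L" scaleX \<Delta>
  proof
    show "norm (\<Delta> a - \<Delta> b) = sup_norm L (\<lambda>t. a t - b t)"
      if "a \<in> E.unit_sphere" "b \<in> E.unit_sphere" for a b
      using assms(3) that by (simp add: sup_isometry_on_def sphere dist_norm)
    show "\<Delta> ` E.unit_sphere = sphere 0 1"
      using assms(4) by (simp add: sphere)
  qed
  show ?thesis
    using real_linear_extension sup_isometry_extension surj_extension extension_eq
    by (intro exI[of _ extension]) (simp add: sphere)
qed

end
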